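(* Let $m\ge 3$, $1\le r\le m$, $n\ge 0$ be integers, let $d=n+m+r-1$, and let $G=K_r+L_{m,n}$ be the graph on $[d]$ whose edges are all pairs of distinct elements of $[r]$, the pairs $\{j,j+1\}$ for $r\le j\le r+n-1$, and all pairs of distinct elements of $\{r+n,\dots,r+n+m-1\}$. Then $$X_G(\mathbf{x};q)=[m-1]_q!\left(\sum_{i=0}^{r-1}q^i[r-1]_q!\,[d-2i]_q\,e_{(d-i,i)}+\sum_{j=0}^{n-1}q[n+m-j-2]_q\,X_{L_{r,j}}(\mathbf{x};q)\,e_{n+m-j-1}\right).$$ Hence $X_G(\mathbf{x};q)$ is $e$-positive and $e$-unimodal with center of symmetry $|E(G)|/2$.
   Context: $[k]_q=1+q+\dots+q^{k-1}$, $[k]_q!=[1]_q\cdots[k]_q$ ($[0]_q!=1$); $e_{(a,b)}=e_ae_b$ with $e_0=1$. For a graph $G$ on a vertex set of positive integers, $X_G(\mathbf{x};q)=\sum_\kappa q^{\mathrm{asc}(\kappa)}x^\kappa$ over proper colorings $\kappa:V(G)\to\mathbb{Z}_{>0}$, where $\mathrm{asc}(\kappa)$ counts edges $\{u,v\}$ with $u<v$, $\kappa(u)<\kappa(v)$, and $x^\kappa=\prod_vx_{\kappa(v)}$. The lollipop graph $L_{r,j}$ ($r\ge1,j\ge0$) is the graph on $[r+j]$ with edges $\{t,t+1\}$ for $1\le t\le j$ and all pairs of distinct elements of $\{j+1,\dots,j+r\}$. Writing $f=\sum_t c_t(\mathbf{x})q^t$: $f$ is $e$-positive if every $c_t$ is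 a nonnegative combination of the $e_\lambda$; $f$ is $e$-unimodal with center of symmetry $c$ if $c_t=c_{2c-t}$ for all $t$ and $c_{t+1}-c_t$ is $e$-positive for $0\le t<c-\tfrac12$. *)

theory Defs
  imports Complex_Main "HOL-Library.Multiset" "HOL-Library.FuncSet"
    "HOL-Computational_Algebra.Polynomial"
begin

text \<open>
  Formal power series in countably many commuting variables.  A monomial is a multiset of
  variable indices: the multiset \<open>{#1, 1, 3#}\<close> is the monomial $x_1^2 x_3$.  The variable
  $x_0$ is available in this type, but the series defined below use only $x_1, x_2, \dots$
\<close>

typedef 'a mps = "UNIV :: (nat multiset \<Rightarrow> 'a) set"
  morphisms mcoeff Abs_mps ..

lemma mcoeff_Abs_mps [simp]: "mcoeff (Abs_mps f) = f"
  by (simp add: Abs_mps_inverse)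

lemma mps_eqI: "(\<And>M. mcoeff f M = mcoeff g M) \<Longrightarrow> f = g"
  by (metis mcoeff_inject ext)

definition splits :: "nat multiset \<Rightarrow> (nat multiset \<times> nat multiset) set" where
  "splits M = {(A, B). A + B = M}"

lemma finite_submultisets: "finite {A. A \<subseteq># (M :: 'b multiset)}"
proof (induction M)
  case empty
  then show ?case by simp
next
  case (add x M)
  have "{A. A \<subseteq># add_mset x M} \<subseteq> {A. A \<subseteq># M} \<union> add_mset x ` {A. A \<subseteq># M}"
  proof
    fix A assume "A \<in> {A. A \<subseteq># add_mset x M}"
    then have A: "A \<subseteq># add_mset x M" by simp
    show "A \<in> {A. A \<subseteq># M} \<union> add_mset x ` {A. A \<subseteq># M}"
    proof (cases "x \<in># A")
      case True
      then obtain B where B: "A = add_mset x B" by (meson multi_member_split)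
      with A have "B \<subseteq># M" by simp
      with B show ?thesis by blast
    next
      case False
      with A have "A \<subseteq># M"
        by (metis add_mset_diff_bothsides diff_single_trivial subset_eq_diff_conv add_mset_add_single)
      then show ?thesis by simp
    qed
  qed
  then show ?case using add.IH by (meson finite_UnI finite_imageI finite_subset)
qed

lemma finite_splits [simp]: "finite (splits M)"
proof (rule finite_subset)
  show "splits M \<subseteq> {A. A \<subseteq># M} \<times> {A. A \<subseteq># M}"
    by (auto simp: splits_def)
  show "finite ({A. A \<subseteq># M} \<times> {A. A \<subseteq># M})"
    using finite_submultisets by blast
qed

instantiation mps :: (comm_ring_1) comm_ring_1
begin

definition zero_mps where "0 = Abs_mps (\<lambda>M. 0)"
definition one_mps where "1 = Abs_mps (\<lambda>M. if M = {#} then 1 else 0)"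
definition plus_mps where "f + g = Abs_mps (\<lambda>M. mcoeff f M + mcoeff g M)"
definition minus_mps where "f - g = Abs_mps (\<lambda>M. mcoeff f M - mcoeff g M)"
definition uminus_mps where "- f = Abs_mps (\<lambda>M. - mcoeff f M)"
definition times_mps where
  "f * g = Abs_mps (\<lambda>M. \<Sum>(A, B)\<in>splits M. mcoeff f A * mcoeff g B)"

instance
proof
  fix f g h :: "'a mps"
  show "f * g * h = f * (g * h)"
  proof (rule mps_eqI)
    fix M
    have "mcoeff (f * g * h) M =
        (\<Sum>(P, C)\<in>splits M. \<Sum>(A, B)\<in>splits P. mcoeff f A * mcoeff g B * mcoeff h C)"
      by (simp add: times_mps_def case_prod_unfold sum_distrib_right)
    also have "\<dots> = (\<Sum>((P, C), (A, B))\<in>(SIGMA p:splits M. splits (fst p)).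
        mcoeff f A * mcoeff g B * mcoeff h C)"
      by (subst sum.Sigma [symmetric]) (auto simp: case_prod_unfold)
    also have "\<dots> = (\<Sum>((A, Q), (B, C))\<in>(SIGMA p:splits M. splits (snd p)).
        mcoeff f A * mcoeff g B * mcoeff h C)"
      by (rule sum.reindex_bij_witness [where
            i = "\<lambda>((A, Q), (B, C)). ((A + B, C), (A, B))" and
            j = "\<lambda>((P, C), (A, B)). ((A, B + C), (B, C))"])
         (auto simp: splits_def add.assoc)
    also have "\<dots> = (\<Sum>(A, Q)\<in>splits M. \<Sum>(B, C)\<in>splits Q. mcoeff f A * mcoeff g B * mcoeff h C)"
      by (subst sum.Sigma [symmetric]) (auto simp: case_prod_unfold)
    also have "\<dots> = mcoeff (f * (g * h)) M"
      by (simp add: times_mps_def case_prod_unfold sum_distrib_left mult.assoc)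
    finally show "mcoeff (f * g * h) M = mcoeff (f * (g * h)) M" .
  qed
  show "f * g = g * f"
  proof (rule mps_eqI)
    fix M
    show "mcoeff (f * g) M = mcoeff (g * f) M"
      unfolding times_mps_def mcoeff_Abs_mps
      by (rule sum.reindex_bij_witness [where i = prod.swap and j = prod.swap])
         (auto simp: splits_def add.commute mult.commute)
  qed
  show "1 * f = f"
  proof (rule mps_eqI)
    fix M
    have *: "({#}, M) \<in> splits M"
      by (simp add: splits_def)
    have "(case p of (A, B) \<Rightarrow> (if A = {#} then 1 else 0) * mcoeff f B) = 0"
      if "p \<in> splits M - {({#}, M)}" for p
    proof -
      obtain A B where p: "p = (A, B)" by (cases p)
      have "A \<noteq> {#}"
      proof
        assume "A = {#}"
        moreover have "A + B = M" using that p by (simp add: splits_def)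
        ultimately have "p = ({#}, M)" using p by simp
        then show False using that by simp
      qed
      with p show ?thesis by simp
    qed
    then have "(\<Sum>(A, B)\<in>splits M. (if A = {#} then 1 else 0) * mcoeff f B) = mcoeff f M"
      by (subst sum.remove [OF finite_splits *]) (simp add: sum.neutral)
    then show "mcoeff (1 * f) M = mcoeff f M"
      by (simp only: times_mps_def one_mps_def mcoeff_Abs_mps)
  qed
  show "(f + g) * h = f * h + g * h"
    by (rule mps_eqI)
       (simp add: times_mps_def plus_mps_def case_prod_unfold distrib_right sum.distrib)
  show "(0 :: 'a mps) \<noteq> 1"
  proof
    assume "(0 :: 'a mps) = 1"
    then have "mcoeff (0 :: 'a mps) {#} = mcoeff 1 {#}" by simp
    then show False by (simp add: zero_mps_def one_mps_def)
  qed
  show "f + g + h = f + (g + h)"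
    by (rule mps_eqI) (simp add: plus_mps_def add.assoc)
  show "f + g = g + f"
    by (rule mps_eqI) (simp add: plus_mps_def add.commute)
  show "0 + f = f"
    by (rule mps_eqI) (simp add: plus_mps_def zero_mps_def)
  show "- f + f = 0"
    by (rule mps_eqI) (simp add: plus_mps_def zero_mps_def uminus_mps_def)
  show "f - g = f + - g"
    by (rule mps_eqI) (simp add: plus_mps_def minus_mps_def uminus_mps_def)
qed

end

definition mps_const :: "'a :: comm_ring_1 \<Rightarrow> 'a mps" where
  "mps_const a = Abs_mps (\<lambda>M. if M = {#} then a else 0)"

definition esym :: "nat \<Rightarrow> 'a :: comm_ring_1 mps" where
  "esym k = Abs_mps (\<lambda>M. if \<exists>S. finite S \<and> S \<subseteq> {1..} \<and> card S = k \<and> M = mset_set S then 1 else 0)"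

lemma esym_0: "esym 0 = 1"
proof -
  have "(\<exists>S. finite S \<and> S \<subseteq> {1..} \<and> card S = 0 \<and> M = mset_set S) \<longleftrightarrow> M = {#}" for M :: "nat multiset"
  proof
    assume "\<exists>S. finite S \<and> S \<subseteq> {1..} \<and> card S = 0 \<and> M = mset_set S"
    then obtain S where "finite S" "card S = 0" "M = mset_set S" by blast
    then show "M = {#}" by simp
  next
    assume "M = {#}"
    then show "\<exists>S. finite S \<and> S \<subseteq> {1..} \<and> card S = 0 \<and> M = mset_set S"
      by (intro exI [of _ "{}"]) simp
  qed
  then show ?thesis
    by (simp only: esym_def one_mps_def)
qed

definition esym_part :: "nat multiset \<Rightarrow> 'a :: comm_ring_1 mps" where
  "esym_part lam = (\<Prod>k\<in>#lam. esym k)"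

text \<open>
  A series in the $x_i$ and $q$ is an element of \<^typ>\<open>int poly mps\<close>: its coefficients are
  polynomials in $q$.
\<close>

definition q :: "int poly" where
  "q = [:0, 1:]"

definition qint :: "nat \<Rightarrow> int poly" where
  "qint k = (\<Sum>i<k. q ^ i)"

definition qfact :: "nat \<Rightarrow> int poly" where
  "qfact k = (\<Prod>i\<in>{1..k}. qint i)"

text \<open>
  The coefficient $c_t(\mathbf{x})$ of $q^t$; it is indexed by an integer, and is zero for
  $t < 0$, so that $c_{2c-t}$ makes sense for all $t$.
\<close>

definition qcoeff :: "int poly mps \<Rightarrow> int \<Rightarrow> int mps" where
  "qcoeff f t = (if t < 0 then 0 else Abs_mps (\<lambda>M. poly.coeff (mcoeff f M) (nat t)))"

definition e_positive_sym :: "int mps \<Rightarrow> bool" where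
  "e_positive_sym f \<longleftrightarrow>
     (\<exists>S a. finite S \<and> (\<forall>lam\<in>S. 0 \<notin># lam \<and> 0 \<le> a lam) \<and>
        f = (\<Sum>lam\<in>S. mps_const (a lam) * esym_part lam))"

definition e_positive :: "int poly mps \<Rightarrow> bool" where
  "e_positive f \<longleftrightarrow> (\<forall>t. e_positive_sym (qcoeff f t))"

definition e_unimodal :: "int poly mps \<Rightarrow> real \<Rightarrow> bool" where
  "e_unimodal f c \<longleftrightarrow>
     (\<exists>N :: int. 2 * c = of_int N \<and> (\<forall>t. qcoeff f t = qcoeff f (N - t))) \<and>
     (\<forall>t :: int. 0 \<le> t \<and> of_int t < c - 1 / 2 \<longrightarrow>
        e_positive_sym (qcoeff f (t + 1) - qcoeff f t))"

text \<open>A graph is a pair of a vertex set and a set of two-element edges.\<close>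

type_synonym graph = "nat set \<times> nat set set"

abbreviation verts :: "graph \<Rightarrow> nat set" where "verts G \<equiv> fst G"
abbreviation edges :: "graph \<Rightarrow> nat set set" where "edges G \<equiv> snd G"

definition complete_edges :: "nat set \<Rightarrow> nat set set" where
  "complete_edges S = {{u, v} |u v. u \<in> S \<and> v \<in> S \<and> u \<noteq> v}"

definition lollipop :: "nat \<Rightarrow> nat \<Rightarrow> graph" where
  "lollipop r j =
     ({1..r + j}, {{t, t + 1} |t. 1 \<le> t \<and> t \<le> j} \<union> complete_edges {j + 1..j + r})"

text \<open>The graph $K_r + L_{m,n}$; the index bounds are meant for $r, m \ge 1$.\<close>

definition K_plus_lollipop :: "nat \<Rightarrow> nat \<Rightarrow> nat \<Rightarrow> graph" where
  "K_plus_lollipop r m n =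
     ({1..n + m + r - 1},
      complete_edges {1..r} \<union> {{j, j + 1} |j. r \<le> j \<and> j \<le> r + n - 1} \<union>
      complete_edges {r + n..r + n + m - 1})"

text \<open>Colorings are extensional functions, so each coloring of the vertex set occurs once.\<close>

definition proper_colorings :: "graph \<Rightarrow> (nat \<Rightarrow> nat) set" where
  "proper_colorings G =
     {\<kappa> \<in> verts G \<rightarrow>\<^sub>E {1..}. \<forall>u v. {u, v} \<in> edges G \<longrightarrow> u \<noteq> v \<longrightarrow> \<kappa> u \<noteq> \<kappa> v}"

definition asc :: "graph \<Rightarrow> (nat \<Rightarrow> nat) \<Rightarrow> nat" where
  "asc G \<kappa> = card {e \<in> edges G. \<exists>u v. e = {u, v} \<and> u < v \<and> \<kappa> u < \<kappa> v}"

definition color_monomial :: "graph \<Rightarrow> (nat \<Rightarrow> nat) \<Rightarrow> nat multiset" where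
  "color_monomial G \<kappa> = image_mset \<kappa> (mset_set (verts G))"

lemma finite_colorings_with_monomial:
  assumes "finite (verts G)"
  shows "finite {\<kappa> \<in> proper_colorings G. color_monomial G \<kappa> = M}"
proof (rule finite_subset)
  show "{\<kappa> \<in> proper_colorings G. color_monomial G \<kappa> = M} \<subseteq> verts G \<rightarrow>\<^sub>E set_mset M"
    using assms by (auto simp: proper_colorings_def color_monomial_def PiE_iff extensional_def)
  show "finite (verts G \<rightarrow>\<^sub>E set_mset M)"
    using assms by (simp add: finite_PiE)
qed

text \<open>
  $X_G(\mathbf{x};q)$, given by its coefficient of each monomial: for a finite vertex set this is
  a finite sum, by the preceding lemma.
\<close>

definition chrom_qsym :: "graph \<Rightarrow> int poly mps" where
  "chrom_qsym G =
     Abs_mps (\<lambda>M. \<Sum>\<kappa> | \<kappa> \<in> proper_colorings G \<and> color_monomial G \<kappa> = M. q ^ asc G \<kappa>)"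

end

theory Submission
  imports Defs "HOL-Combinatorics.Multiset_Permutations"
begin

text \<open>
  Factoring out the orderings of the upper clique, write $X_{H + L_{m,n}} = [m-1]_q!\, C_{m,n}$.
  The last path vertex together with the rest of the clique uses a set of $m$ colors, and
  comparing weights for a fixed such set gives
  $C_{m,n} = C_{m+1,n-1} + q[m-1]_q e_m X_{H + P_{n-1}}$, where $H + P_{n-1}$ carries a path of
  $n-1$ edges.  Iterating for $H = K_r$ leaves two cliques sharing a vertex, which a telescoping
  sum evaluates, and the mirror images of the lollipops $L_{r,j}$.  Mirroring a lollipop reverses
  the order of the colors, which is harmless since its own recursion does not see that order.
  Each summand of the formula is a nonnegative combination of terms
  $q^i [N+1-2i]_q e_\lambda$ with $N$ the number of edges, and such combinations are closed
  under products, with the values of $N$ adding up.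
\<close>

section \<open>Generating series of weighted families\<close>

text \<open>The vertex at which a clique is glued on sees the other colors of the clique only as a
  set, so their arrangements contribute a separate factor. Now fix the set V of m colors and the
  color k of the path vertex before the clique. The choices of c in V - {k} have total weight
  q[m-1]_q, plus the weight that k would have if the whole of V were glued on at k, the latter only
  when k is not in V. The first part does not depend on V and therefore produces e_m; the second is
  the series of a larger clique on a shorter path. These are equalities of totals over fibres, not
  matchings of single colorings, so the proof is set up around fibre sums.

  Unimodality is not preserved by sums with different centers. Hence twice the center is carried
  along as a number N, and every summand must reach the same N. This N is the number of edges
  because q[k]_q carries k + 1 and [k]_q! carries k(k-1)/2. The assumption r <= m enters by keeping
  every block [d-2i]_q nonempty, so that the subtractions are genuine.\<close>

definition locally_finite :: "'i set \<Rightarrow> ('i \<Rightarrow> nat multiset) \<Rightarrow> bool" where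
  "locally_finite A mon \<longleftrightarrow> (\<forall>M. finite {x \<in> A. mon x = M})"

definition gen :: "'i set \<Rightarrow> ('i \<Rightarrow> nat multiset) \<Rightarrow> ('i \<Rightarrow> 'a :: comm_ring_1) \<Rightarrow> 'a mps" where
  "gen A mon w = Abs_mps (\<lambda>M. \<Sum>x | x \<in> A \<and> mon x = M. w x)"

lemma mcoeff_gen: "mcoeff (gen A mon w) M = (\<Sum>x | x \<in> A \<and> mon x = M. w x)"
  by (simp add: gen_def)

lemma mcoeff_add: "mcoeff (f + g) M = mcoeff f M + mcoeff g M"
  by (simp add: plus_mps_def)

lemma mcoeff_0: "mcoeff 0 M = 0"
  by (simp add: zero_mps_def)

lemma mcoeff_const_mult: "mcoeff (mps_const c * f) M = c * mcoeff f M"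
proof -
  have "mcoeff (mps_const c * f) M =
      (\<Sum>(A, B)\<in>splits M. (if A = {#} then c else 0) * mcoeff f B)"
    by (simp add: times_mps_def mps_const_def)
  also have "\<dots> = (\<Sum>(A, B)\<in>{({#} :: nat multiset, M)}. (if A = {#} then c else 0) * mcoeff f B)"
    by (rule sum.mono_neutral_right [OF finite_splits]) (auto simp: splits_def split: if_splits)
  finally show ?thesis by simp
qed

lemma mps_const_mult: "mps_const (a * b) = mps_const a * mps_const b"
proof (rule mps_eqI)
  fix M
  show "mcoeff (mps_const (a * b)) M = mcoeff (mps_const a * mps_const b) M"
    by (simp add: mcoeff_const_mult) (simp add: mps_const_def)
qed

lemma mps_const_0: "mps_const 0 = 0"
  by (rule mps_eqI) (simp add: mps_const_def zero_mps_def)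

lemma mps_const_1: "mps_const 1 = 1"
  by (simp add: mps_const_def one_mps_def)

lemma mps_const_add: "mps_const (a + b) = mps_const a + mps_const b"
proof (rule mps_eqI)
  fix M
  show "mcoeff (mps_const (a + b)) M = mcoeff (mps_const a + mps_const b) M"
    unfolding mcoeff_add by (simp add: mps_const_def)
qed

lemma mps_const_sum: "mps_const (\<Sum>x\<in>A. f x) = (\<Sum>x\<in>A. mps_const (f x))"
  by (induction A rule: infinite_finite_induct) (simp_all add: mps_const_0 mps_const_add)

lemma locally_finite_subset:
  "locally_finite B mon \<Longrightarrow> A \<subseteq> B \<Longrightarrow> locally_finite A mon"
  unfolding locally_finite_def
proof
  fix M
  assume "\<forall>M. finite {x \<in> B. mon x = M}" and "A \<subseteq> B"
  then have "finite {x \<in> B. mon x = M}" and "{x \<in> A. mon x = M} \<subseteq> {x \<in> B. mon x = M}"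
    by auto
  then show "finite {x \<in> A. mon x = M}"
    by (rule rev_finite_subset)
qed

lemma locally_finite_Times:
  assumes "locally_finite A f" and "locally_finite B g"
  shows "locally_finite (A \<times> B) (\<lambda>(x, y). f x + g y)"
  unfolding locally_finite_def
proof
  fix M
  have "{p \<in> A \<times> B. (case p of (x, y) \<Rightarrow> f x + g y) = M} \<subseteq>
      (\<Union>(P, Q)\<in>splits M. {x \<in> A. f x = P} \<times> {y \<in> B. g y = Q})"
    by (auto simp: splits_def)
  moreover have "finite \<dots>"
    using assms by (auto simp: locally_finite_def)
  ultimately show "finite {p \<in> A \<times> B. (case p of (x, y) \<Rightarrow> f x + g y) = M}"
    by (rule finite_subset)
qed

lemma gen_reindex:
  assumes "bij_betw h A B" and "\<And>x. x \<in> A \<Longrightarrow> mon' (h x) = mon x"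
    and "\<And>x. x \<in> A \<Longrightarrow> w' (h x) = w x"
  shows "gen A mon w = gen B mon' w'"
proof (rule mps_eqI)
  fix M
  have "bij_betw h {x \<in> A. mon x = M} {y \<in> B. mon' y = M}"
    using assms(1,2) unfolding bij_betw_def inj_on_def by auto
  from sum.reindex_bij_betw [OF this, of w'] assms(3)
  show "mcoeff (gen A mon w) M = mcoeff (gen B mon' w') M"
    by (simp add: mcoeff_gen cong: conj_cong)
qed

text \<open>Only the total weight on each fibre of \<open>h\<close> has to match, so the two index
  sets may have different sizes. Local finiteness is what allows regrouping: an infinite
  \<open>sum\<close> would be 0 by convention.\<close>

lemma gen_fibre:
  assumes "locally_finite A mon" and "locally_finite B mon'"
    and "\<And>x. x \<in> A \<Longrightarrow> h x \<in> B \<and> mon' (h x) = mon x"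
    and "\<And>y. y \<in> B \<Longrightarrow> (\<Sum>x | x \<in> A \<and> h x = y. w x) = w' y"
  shows "gen A mon w = gen B mon' w'"
proof (rule mps_eqI)
  fix M
  have "(\<Sum>x | x \<in> A \<and> mon x = M. w x) =
      (\<Sum>y | y \<in> B \<and> mon' y = M. \<Sum>x | x \<in> {x. x \<in> A \<and> mon x = M} \<and> h x = y. w x)"
    using assms(1-3) by (intro sum.group [symmetric]) (auto simp: locally_finite_def)
  also have "\<dots> = (\<Sum>y | y \<in> B \<and> mon' y = M. w' y)"
  proof (rule sum.cong [OF refl])
    fix y assume y: "y \<in> {y. y \<in> B \<and> mon' y = M}"
    then have "{x. x \<in> {x. x \<in> A \<and> mon x = M} \<and> h x = y} = {x. x \<in> A \<and> h x = y}"
      using assms(3) by auto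
    then show "(\<Sum>x | x \<in> {x. x \<in> A \<and> mon x = M} \<and> h x = y. w x) = w' y"
      using y assms(4) by simp
  qed
  finally show "mcoeff (gen A mon w) M = mcoeff (gen B mon' w') M"
    by (simp add: mcoeff_gen)
qed

lemma gen_cong:
  assumes "\<And>x. x \<in> A \<Longrightarrow> w x = w' x"
  shows "gen A mon w = gen A mon w'"
  by (rule mps_eqI) (auto simp: mcoeff_gen assms intro: sum.cong)

lemma gen_add: "gen A mon (\<lambda>x. w x + w' x) = gen A mon w + gen A mon w'"
  by (rule mps_eqI) (simp add: mcoeff_gen mcoeff_add sum.distrib)

lemma gen_const_mult: "gen A mon (\<lambda>x. c * w x) = mps_const c * gen A mon w"
  by (rule mps_eqI) (simp add: mcoeff_gen mcoeff_const_mult sum_distrib_left)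

lemma gen_filter:
  assumes "locally_finite A mon"
  shows "gen {x \<in> A. P x} mon w = gen A mon (\<lambda>x. if P x then w x else 0)"
proof (rule mps_eqI)
  fix M
  have "finite {x \<in> A. mon x = M}"
    using assms by (simp add: locally_finite_def)
  then show "mcoeff (gen {x \<in> A. P x} mon w) M = mcoeff (gen A mon (\<lambda>x. if P x then w x else 0)) M"
    unfolding mcoeff_gen by (intro sum.mono_neutral_cong_left) auto
qed

lemma gen_mult:
  assumes "locally_finite A f" and "locally_finite B g"
  shows "gen A f u * gen B g v = gen (A \<times> B) (\<lambda>(x, y). f x + g y) (\<lambda>(x, y). u x * v y)"
proof (rule mps_eqI)
  fix M
  let ?F = "\<lambda>P. {x \<in> A. f x = P}" and ?G = "\<lambda>Q. {y \<in> B. g y = Q}"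
  have fin: "finite (?F P)" "finite (?G Q)" for P Q
    using assms by (auto simp: locally_finite_def)
  have "mcoeff (gen A f u * gen B g v) M =
      (\<Sum>(P, Q)\<in>splits M. \<Sum>(x, y)\<in>?F P \<times> ?G Q. u x * v y)"
    by (simp add: times_mps_def mcoeff_gen sum_product sum.cartesian_product case_prod_unfold)
  also have "\<dots> = (\<Sum>z | z \<in> A \<times> B \<and> (case z of (x, y) \<Rightarrow> f x + g y) = M.
      case z of (x, y) \<Rightarrow> u x * v y)" (is "_ = sum _ ?Z")
  proof -
    have "sum (\<lambda>(x, y). u x * v y) ?Z = (\<Sum>p\<in>splits M.
        \<Sum>z | z \<in> ?Z \<and> (case z of (x, y) \<Rightarrow> (f x, g y)) = p. case z of (x, y) \<Rightarrow> u x * v y)"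
      using locally_finite_Times [OF assms]
      by (intro sum.group [symmetric] finite_splits) (auto simp: locally_finite_def splits_def)
    also have "\<dots> = (\<Sum>(P, Q)\<in>splits M. \<Sum>(x, y)\<in>?F P \<times> ?G Q. u x * v y)"
      by (intro sum.cong) (auto simp: splits_def case_prod_unfold intro!: sum.cong)
    finally show ?thesis by simp
  qed
  finally show "mcoeff (gen A f u * gen B g v) M =
      mcoeff (gen (A \<times> B) (\<lambda>(x, y). f x + g y) (\<lambda>(x, y). u x * v y)) M"
    by (simp add: mcoeff_gen)
qed

section \<open>Sets of colors and elementary symmetric functions\<close>

definition ksets :: "nat \<Rightarrow> nat set set" where
  "ksets k = {S. finite S \<and> S \<subseteq> {1..} \<and> card S = k}"

lemma locally_finite_ksets: "locally_finite (ksets k) mset_set"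
  unfolding locally_finite_def
proof
  fix M
  have "{S \<in> ksets k. mset_set S = M} \<subseteq> {set_mset M}"
    by (auto simp: ksets_def)
  then show "finite {S \<in> ksets k. mset_set S = M}"
    by (rule finite_subset) simp
qed

lemma locally_finite_mset: "locally_finite A mset"
  unfolding locally_finite_def
proof
  fix M
  show "finite {x \<in> A. mset x = M}"
    using finite_permutations_of_multiset [of M]
    by (rule finite_subset [rotated]) (auto simp: permutations_of_multiset_def)
qed

lemma esym_eq_gen: "esym k = gen (ksets k) mset_set (\<lambda>_. 1)"
proof (rule mps_eqI)
  fix M
  have "{S \<in> ksets k. mset_set S = M} =
      (if \<exists>S. finite S \<and> S \<subseteq> {1..} \<and> card S = k \<and> M = mset_set S then {set_mset M} else {})"
    by (auto simp: ksets_def)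
  then show "mcoeff (esym k) M = mcoeff (gen (ksets k) mset_set (\<lambda>_. 1 :: 'a)) M"
    by (auto simp: mcoeff_gen esym_def)
qed

lemma insert_ksets: "c \<notin> S \<Longrightarrow> 1 \<le> c \<Longrightarrow> S \<in> ksets k \<Longrightarrow> insert c S \<in> ksets (Suc k)"
  by (auto simp: ksets_def)

lemma remove_ksets: "c \<in> S \<Longrightarrow> S \<in> ksets (Suc k) \<Longrightarrow> S - {c} \<in> ksets k"
  by (auto simp: ksets_def)

lemma finite_kset: "S \<in> ksets k \<Longrightarrow> finite S"
  by (simp add: ksets_def)

lemma card_kset: "S \<in> ksets k \<Longrightarrow> card S = k"
  by (simp add: ksets_def)

lemma kset_pos: "S \<in> ksets k \<Longrightarrow> x \<in> S \<Longrightarrow> 1 \<le> x"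
  by (auto simp: ksets_def)

section \<open>Ranks in a strict total order and q-integers\<close>

definition strict_total :: "('b \<Rightarrow> 'b \<Rightarrow> bool) \<Rightarrow> bool" where
  "strict_total R \<longleftrightarrow> transp R \<and> totalp R \<and> irreflp R"

lemma strict_total_less: "strict_total ((<) :: 'b :: linorder \<Rightarrow> 'b \<Rightarrow> bool)"
  by (auto simp: strict_total_def transp_def totalp_on_def irreflp_def)

lemma strict_total_conversep: "strict_total R \<Longrightarrow> strict_total (\<lambda>x y. R y x)"
  unfolding strict_total_def transp_def totalp_on_def irreflp_def by blast

lemma qint_Suc: "qint (Suc k) = qint k + q ^ k"
  by (simp add: qint_def)

lemma qint_0: "qint 0 = 0"
  by (simp add: qint_def)

lemma qfact_0: "qfact 0 = 1"
  by (simp add: qfact_def)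

lemma qfact_Suc: "qfact (Suc k) = qint (Suc k) * qfact k"
  by (simp add: qfact_def mult.commute)

text \<open>Both \<open>cut_identity\<close> and \<open>qint_mult\<close> are proved after
  multiplication by \<open>q - 1\<close>, where geometric sums become differences of powers; the
  factor cancels afterwards.\<close>

lemma q_minus_1_qint: "(q - 1) * qint k = q ^ k - 1"
  by (induction k) (simp_all add: qint_0 qint_Suc algebra_simps)

lemma bij_betw_rank:
  assumes "strict_total R" and "finite V"
  shows "bij_betw (\<lambda>c. card {t \<in> V. R c t}) V {..<card V}"
proof -
  have less: "card {t \<in> V. R c t} < card {t \<in> V. R d t}" if "R d c" "c \<in> V" for c d
  proof (rule psubset_card_mono)
    show "{t \<in> V. R c t} \<subset> {t \<in> V. R d t}"
      using assms(1) that unfolding strict_total_def transp_def irreflp_def by blast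
  qed (use assms in auto)
  have inj: "inj_on (\<lambda>c. card {t \<in> V. R c t}) V"
  proof (rule inj_onI)
    fix c d assume "c \<in> V" "d \<in> V" "card {t \<in> V. R c t} = card {t \<in> V. R d t}"
    then show "c = d"
      using assms(1) less [of c d] less [of d c] unfolding strict_total_def totalp_on_def by auto
  qed
  have "card {t \<in> V. R c t} < card V" if "c \<in> V" for c
    using that assms by (intro psubset_card_mono) (auto simp: strict_total_def irreflp_def)
  then have "(\<lambda>c. card {t \<in> V. R c t}) ` V \<subseteq> {..<card V}" by auto
  then have "(\<lambda>c. card {t \<in> V. R c t}) ` V = {..<card V}"
    using inj by (intro card_subset_eq) (auto simp: card_image)
  with inj show ?thesis by (simp add: bij_betw_def)
qed

lemma sum_q_rank:
  assumes "strict_total R" and "finite V"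
  shows "(\<Sum>c\<in>V. q ^ card {t \<in> V. R c t}) = qint (card V)"
  unfolding qint_def using sum.reindex_bij_betw [OF bij_betw_rank [OF assms], of "\<lambda>i. q ^ i"] by simp

text \<open>The exponents run through 1, ..., p and then p, ..., k: the value p is hit once more
  than in 1, ..., k, which explains the extra summand.\<close>

lemma sum_q_skip:
  "p \<le> Suc k \<Longrightarrow> (\<Sum>i<Suc k. q ^ (if i < p then Suc i else i)) = q * qint k + q ^ p"
proof (induction k arbitrary: p)
  case 0
  then show ?case by (cases p) (auto simp: qint_0)
next
  case (Suc k)
  show ?case
  proof (cases "p \<le> Suc k")
    case True
    then show ?thesis
      using Suc.IH [of p] by (subst sum.lessThan_Suc) (simp add: qint_Suc algebra_simps)
  next
    case False
    then have p: "p = Suc (Suc k)" using Suc.prems by simp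
    have "(\<Sum>i<Suc (Suc k). q ^ (if i < p then Suc i else i)) = q * qint (Suc (Suc k))"
      unfolding qint_def sum_distrib_left p by (intro sum.cong) auto
    then show ?thesis by (simp add: p qint_Suc algebra_simps)
  qed
qed

text \<open>If \<open>k\<close> lies in \<open>V\<close>, the extra 1 for \<open>c\<close> above
  \<open>k\<close> replaces the contribution of \<open>k\<close> itself to the rank of
  \<open>c\<close> below \<open>k\<close>, so every exponent is one more than a rank in
  \<open>V - {k}\<close>. If not, the elements above \<open>k\<close> are those of rank below
  \<open>p\<close>, and raising just these exponents doubles the power \<open>q ^ p\<close>.\<close>

lemma sum_q_rank_except:
  assumes R: "strict_total R" and fin: "finite V" and card: "card V = Suc a"
  shows "(\<Sum>c\<in>V - {k}. q ^ ((if R k c then 1 else 0) + card {t \<in> V. R c t})) =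
    q * qint a + (if k \<in> V then 0 else q ^ card {t \<in> V. R k t})"
proof (cases "k \<in> V")
  case True
  have "(if R k c then 1 else 0) + card {t \<in> V. R c t} = Suc (card {t \<in> V - {k}. R c t})"
    if c: "c \<in> V - {k}" for c
  proof (cases "R k c")
    case True
    then have "{t \<in> V. R c t} = {t \<in> V - {k}. R c t}"
      using R unfolding strict_total_def transp_def irreflp_def by blast
    with True show ?thesis by simp
  next
    case False
    then have "R c k"
      using R c unfolding strict_total_def totalp_on_def by auto
    then have "{t \<in> V. R c t} = insert k {t \<in> V - {k}. R c t}"
      using \<open>k \<in> V\<close> by auto
    with False fin show ?thesis by simp
  qed
  then have "(\<Sum>c\<in>V - {k}. q ^ ((if R k c then 1 else 0) + card {t \<in> V. R c t})) =
      (\<Sum>c\<in>V - {k}. q * q ^ card {t \<in> V - {k}. R c t})"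
    by (intro sum.cong) simp_all
  also have "\<dots> = q * qint a"
    using sum_q_rank [OF R, of "V - {k}"] fin card True by (simp flip: sum_distrib_left)
  finally show ?thesis using True by simp
next
  case False
  define p where "p = card {t \<in> V. R k t}"
  have "p \<le> Suc a"
    unfolding p_def card [symmetric] using fin by (intro card_mono) auto
  have "R k c \<longleftrightarrow> card {t \<in> V. R c t} < p" if c: "c \<in> V" for c
  proof (cases "R k c")
    case True
    have "{t \<in> V. R c t} \<subset> {t \<in> V. R k t}"
      using R c True unfolding strict_total_def transp_def irreflp_def by blast
    then show ?thesis
      using True fin psubset_card_mono [of "{t \<in> V. R k t}"] by (simp add: p_def)
  next
    case False
    then have "R c k"
      using R c \<open>k \<notin> V\<close> unfolding strict_total_def totalp_on_def by (cases "c = k") auto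
    then have "{t \<in> V. R k t} \<subseteq> {t \<in> V. R c t}"
      using R unfolding strict_total_def transp_def by blast
    then have "p \<le> card {t \<in> V. R c t}"
      unfolding p_def using fin by (intro card_mono) auto
    with False show ?thesis by simp
  qed
  then have "(\<Sum>c\<in>V - {k}. q ^ ((if R k c then 1 else 0) + card {t \<in> V. R c t})) =
      (\<Sum>c\<in>V. (\<lambda>i. q ^ (if i < p then Suc i else i)) (card {t \<in> V. R c t}))"
    using False by (intro sum.cong) auto
  also have "\<dots> = (\<Sum>i<Suc a. q ^ (if i < p then Suc i else i))"
    using sum.reindex_bij_betw [OF bij_betw_rank [OF R fin], of "\<lambda>i. q ^ (if i < p then Suc i else i)"]
    by (simp only: card)
  also have "\<dots> = q * qint a + q ^ p"
    by (rule sum_q_skip) fact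
  finally show ?thesis using False by (simp add: p_def)
qed

section \<open>Colorings as words\<close>

text \<open>
  A word lists the colors from the last vertex down to the first; the entry of \<open>as\<close> at a
  position says to how many of the preceding vertices, counted backwards from its own, the
  vertex is joined.  The order \<open>R\<close> stands for \<open><\<close> or \<open>>\<close>: reversing a
  word turns ascents into descents.
\<close>

fun proper_word :: "nat list \<Rightarrow> nat list \<Rightarrow> bool" where
  "proper_word [] [] = True"
| "proper_word (a # as) (c # cs) = (1 \<le> c \<and> c \<notin> set (take a cs) \<and> proper_word as cs)"
| "proper_word _ _ = False"

fun word_asc :: "(nat \<Rightarrow> nat \<Rightarrow> bool) \<Rightarrow> nat list \<Rightarrow> nat list \<Rightarrow> nat" where
  "word_asc R (a # as) (c # cs) = length (filter (\<lambda>x. R x c) (take a cs)) + word_asc R as cs"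
| "word_asc _ _ _ = 0"

definition word_gen :: "(nat \<Rightarrow> nat \<Rightarrow> bool) \<Rightarrow> nat list \<Rightarrow> int poly mps" where
  "word_gen R as = gen {cs. proper_word as cs} mset (\<lambda>cs. q ^ word_asc R as cs)"

definition clique_index :: "nat \<Rightarrow> nat list \<Rightarrow> (nat list \<times> nat set) set" where
  "clique_index a as = {(cs, T). proper_word as cs \<and> T \<in> ksets a \<and> hd cs \<notin> T}"

text \<open>
  Colorings of \<open>as\<close> with a clique of \<open>a\<close> new vertices glued on at the last
  vertex, where only the set \<open>T\<close> of the new colors is recorded; summing over its
  arrangements gives the factor \<open>[a]!\<close>.
\<close>

definition clique_gen :: "(nat \<Rightarrow> nat \<Rightarrow> bool) \<Rightarrow> nat \<Rightarrow> nat list \<Rightarrow> int poly mps" where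
  "clique_gen R a as = gen (clique_index a as) (\<lambda>(cs, T). mset cs + mset_set T)
     (\<lambda>(cs, T). q ^ (word_asc R as cs + card {t \<in> T. R (hd cs) t}))"

lemma proper_word_length: "proper_word as cs \<Longrightarrow> length cs = length as"
  by (induction as cs rule: proper_word.induct) auto

lemma locally_finite_word_ksets:
  "locally_finite ({cs. proper_word as cs} \<times> ksets a) (\<lambda>(cs, T). mset cs + mset_set T)"
  by (intro locally_finite_Times locally_finite_mset locally_finite_ksets)

lemma locally_finite_clique_index:
  "locally_finite (clique_index a as) (\<lambda>(cs, T). mset cs + mset_set T)"
  by (rule locally_finite_subset [OF locally_finite_word_ksets [of as a]])
     (auto simp: clique_index_def)

lemma clique_index_ConsE:
  assumes "x \<in> clique_index a (b # as)"
  obtains c cs T where "x = (c # cs, T)" "proper_word (b # as) (c # cs)" "T \<in> ksets a" "c \<notin> T"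
proof (cases x)
  case (Pair ds T)
  with assms that show ?thesis by (cases ds) (auto simp: clique_index_def)
qed

section \<open>Cliques inside words\<close>

abbreviation stair :: "nat \<Rightarrow> nat list" where
  "stair a \<equiv> rev [0..<a]"

text \<open>\<open>stair a\<close> is the sequence of a clique standing alone. In
  \<open>stair1 a\<close> each vertex also reaches the vertex that follows the block, so a prefix
  \<open>stair1 a\<close> makes a clique of \<open>a + 1\<close> vertices with that vertex.\<close>

abbreviation stair1 :: "nat \<Rightarrow> nat list" where
  "stair1 a \<equiv> rev [1..<Suc a]"

lemma stair_Suc: "stair (Suc a) = stair1 a @ [0]"
  by (simp only: rev.simps(2) [symmetric] upt_conv_Cons [symmetric] zero_less_Suc One_nat_def)

lemma proper_word_stair:
  "proper_word (stair a) ts \<longleftrightarrow> length ts = a \<and> distinct ts \<and> (\<forall>t\<in>set ts. 1 \<le> t)"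
proof (induction a arbitrary: ts)
  case 0
  then show ?case by (cases ts) auto
next
  case (Suc a)
  then show ?case by (cases ts) auto
qed

text \<open>This is the generating function of inversions. The head \<open>c\<close> contributes its
  rank in \<open>S\<close>, whatever the order of the remaining entries, so the sum over heads
  splits off one q-integer.\<close>

lemma sum_permutations_of_set:
  assumes R: "strict_total R" and "finite S"
  shows "(\<Sum>ts\<in>permutations_of_set S. q ^ word_asc R (stair (card S)) ts) = qfact (card S)"
  using assms(2)
proof (induction "card S" arbitrary: S)
  case 0
  then show ?case by (simp add: qfact_0)
next
  case (Suc a)
  then have "S \<noteq> {}" by auto
  have card: "card (S - {c}) = a" if "c \<in> S" for c
    using that Suc.hyps(2) Suc.prems by simp
  have "(\<Sum>ts\<in>permutations_of_set S. q ^ word_asc R (stair (Suc a)) ts) =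
      (\<Sum>c\<in>S. \<Sum>ts\<in>(#) c ` permutations_of_set (S - {c}). q ^ word_asc R (stair (Suc a)) ts)"
    using Suc.prems permutations_of_set_nonempty [OF \<open>S \<noteq> {}\<close>]
    by (simp only:, intro sum.UNION_disjoint) auto
  also have "\<dots> = (\<Sum>c\<in>S. q ^ card {t \<in> S. R t c} * qfact a)"
  proof (rule sum.cong [OF refl])
    fix c assume c: "c \<in> S"
    have eq: "word_asc R (stair (Suc a)) (c # ts) = card {t \<in> S. R t c} + word_asc R (stair a) ts"
      if "ts \<in> permutations_of_set (S - {c})" for ts
    proof -
      have ts: "set ts = S - {c}" "distinct ts"
        using that by (auto simp: permutations_of_set_def)
      then have "length ts = a"
        using card [OF c] distinct_card by metis
      moreover have "length (filter (\<lambda>x. R x c) ts) = card {t \<in> S. R t c}"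
      proof -
        have "set (filter (\<lambda>x. R x c) ts) = {t \<in> S. R t c}"
          using ts R by (auto simp: strict_total_def irreflp_def)
        then show ?thesis
          using ts(2) by (metis distinct_card distinct_filter)
      qed
      ultimately show ?thesis by simp
    qed
    have "(\<Sum>ts\<in>(#) c ` permutations_of_set (S - {c}). q ^ word_asc R (stair (Suc a)) ts) =
        (\<Sum>ts\<in>permutations_of_set (S - {c}). q ^ word_asc R (stair (Suc a)) (c # ts))"
      by (subst sum.reindex) auto
    also have "\<dots> = (\<Sum>ts\<in>permutations_of_set (S - {c}).
        q ^ card {t \<in> S. R t c} * q ^ word_asc R (stair a) ts)"
      by (intro sum.cong refl) (simp only: eq power_add)
    also have "\<dots> = q ^ card {t \<in> S. R t c} * qfact a"
      using Suc.hyps(1) [of "S - {c}"] Suc.prems card [OF c]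
      by (simp flip: sum_distrib_left)
    finally show "(\<Sum>ts\<in>(#) c ` permutations_of_set (S - {c}). q ^ word_asc R (stair (Suc a)) ts) =
        q ^ card {t \<in> S. R t c} * qfact a" .
  qed
  also have "\<dots> = qfact (Suc a)"
    using sum_q_rank [OF strict_total_conversep [OF R] Suc.prems]
    by (simp add: qfact_Suc Suc.hyps(2) [symmetric] flip: sum_distrib_right)
  finally show ?case by (simp only: Suc.hyps(2) [symmetric])
qed

text \<open>Every vertex of the prefix looks back over the rest of the prefix and exactly one vertex
  beyond, so the prefix interacts with the remaining word only through \<open>hd cs\<close>.\<close>

lemma proper_word_append:
  assumes "as \<noteq> []"
  shows "proper_word (stair1 (length ts) @ as) (ts @ cs) \<longleftrightarrow>
    proper_word as cs \<and> distinct ts \<and> hd cs \<notin> set ts \<and> (\<forall>t\<in>set ts. 1 \<le> t)"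
proof (induction ts)
  case Nil
  then show ?case by simp
next
  case (Cons t ts)
  have "take (Suc (length ts)) (ts @ cs) = ts @ [hd cs]" if "proper_word as cs"
    using proper_word_length [OF that] assms by (cases cs) auto
  then show ?case using Cons.IH by auto
qed

text \<open>The middle term, the ascents along edges at the glued vertex, depends only on which
  entries occur in \<open>ts\<close>; the last term is the only one that sees their order.\<close>

lemma word_asc_append:
  assumes "cs \<noteq> []"
  shows "word_asc R (stair1 (length ts) @ as) (ts @ cs) =
    word_asc R as cs + length (filter (R (hd cs)) ts) + word_asc R (stair (length ts)) ts"
proof (induction ts)
  case Nil
  then show ?case by simp
next
  case (Cons t ts)
  have "take (Suc (length ts)) (ts @ cs) = ts @ [hd cs]"
    using assms by (cases cs) auto
  then show ?case using Cons.IH by simp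
qed

lemma word_gen_clique:
  assumes R: "strict_total R" and "as \<noteq> []"
  shows "word_gen R (stair1 a @ as) = mps_const (qfact a) * clique_gen R a as"
  unfolding clique_gen_def word_gen_def gen_const_mult [symmetric]
proof (rule gen_fibre [where h = "\<lambda>xs. (drop a xs, set (take a xs))"])
  fix xs assume "xs \<in> {cs. proper_word (stair1 a @ as) cs}"
  then have xs: "proper_word (stair1 a @ as) xs" by simp
  have l: "length (take a xs) = a"
    using proper_word_length [OF xs] by simp
  have "proper_word as (drop a xs) \<and> distinct (take a xs) \<and> hd (drop a xs) \<notin> set (take a xs) \<and>
      (\<forall>t\<in>set (take a xs). 1 \<le> t)"
    using proper_word_append [OF assms(2), of "take a xs" "drop a xs"] xs
    unfolding l append_take_drop_id by simp
  moreover from this l have "card (set (take a xs)) = a" by (metis distinct_card)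
  moreover have "mset (drop a xs) + mset (take a xs) = mset xs"
    by (metis append_take_drop_id mset_append add.commute)
  ultimately show "(drop a xs, set (take a xs)) \<in> clique_index a as \<and>
      (case (drop a xs, set (take a xs)) of (cs, T) \<Rightarrow> mset cs + mset_set T) = mset xs"
    by (auto simp: clique_index_def ksets_def mset_set_set)
next
  fix y assume "y \<in> clique_index a as"
  then obtain cs T where y: "y = (cs, T)" "proper_word as cs" "T \<in> ksets a" "hd cs \<notin> T"
    by (auto simp: clique_index_def)
  have ne: "cs \<noteq> []"
    using proper_word_length [OF y(2)] assms(2) by auto
  have ts: "length ts = a" "distinct ts" "set ts = T" if "ts \<in> permutations_of_set T" for ts
    using that card_kset [OF y(3)] by (auto simp: permutations_of_set_def distinct_card)
  have "(\<Sum>xs | xs \<in> {cs. proper_word (stair1 a @ as) cs} \<and> (drop a xs, set (take a xs)) = y.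
        q ^ word_asc R (stair1 a @ as) xs) =
      (\<Sum>ts\<in>permutations_of_set T. q ^ word_asc R (stair1 a @ as) (ts @ cs))"
  proof (rule sum.reindex_bij_witness [where i = "\<lambda>ts. ts @ cs" and j = "take a"])
    fix xs assume "xs \<in> {xs. xs \<in> {cs. proper_word (stair1 a @ as) cs} \<and>
        (drop a xs, set (take a xs)) = y}"
    then have xs: "proper_word (stair1 a @ as) xs" "drop a xs = cs" "set (take a xs) = T"
      using y by auto
    have l: "length (take a xs) = a"
      using proper_word_length [OF xs(1)] by simp
    show eq: "take a xs @ cs = xs" using xs(2) append_take_drop_id by metis
    have "distinct (take a xs)"
      using proper_word_append [OF assms(2), of "take a xs" cs] xs(1) unfolding l eq by simp
    then show "take a xs \<in> permutations_of_set T"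
      using xs(3) by (simp add: permutations_of_set_def)
    show "q ^ word_asc R (stair1 a @ as) (take a xs @ cs) = q ^ word_asc R (stair1 a @ as) xs"
      by (simp only: eq)
  next
    fix b assume b: "b \<in> permutations_of_set T"
    show "take a (b @ cs) = b" using ts [OF b] by simp
    have "proper_word (stair1 a @ as) (b @ cs)"
      using proper_word_append [OF assms(2), of b cs] ts [OF b] y kset_pos [OF y(3)] by auto
    then show "b @ cs \<in> {xs. xs \<in> {cs. proper_word (stair1 a @ as) cs} \<and>
        (drop a xs, set (take a xs)) = y}"
      using ts [OF b] y(1) by simp
  qed
  also have "\<dots> = (\<Sum>ts\<in>permutations_of_set T.
      q ^ (word_asc R as cs + card {t \<in> T. R (hd cs) t}) * q ^ word_asc R (stair (card T)) ts)"
  proof (rule sum.cong [OF refl])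
    fix b assume b: "b \<in> permutations_of_set T"
    have "set (filter (R (hd cs)) b) = {t \<in> T. R (hd cs) t}" using ts [OF b] by auto
    then have "length (filter (R (hd cs)) b) = card {t \<in> T. R (hd cs) t}"
      using ts [OF b] by (metis distinct_card distinct_filter)
    then show "q ^ word_asc R (stair1 a @ as) (b @ cs) =
        q ^ (word_asc R as cs + card {t \<in> T. R (hd cs) t}) * q ^ word_asc R (stair (card T)) b"
      using word_asc_append [OF ne, of R b as] ts [OF b] card_kset [OF y(3)]
      by (simp add: power_add)
  qed
  also have "\<dots> = qfact a * q ^ (word_asc R as cs + card {t \<in> T. R (hd cs) t})"
    using sum_permutations_of_set [OF R finite_kset [OF y(3)]] card_kset [OF y(3)]
    by (simp flip: sum_distrib_left)
  finally show "(\<Sum>xs | xs \<in> {cs. proper_word (stair1 a @ as) cs} \<and> (drop a xs, set (take a xs)) = y.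
        q ^ word_asc R (stair1 a @ as) xs) =
      qfact a * (case y of (cs, T) \<Rightarrow> q ^ (word_asc R as cs + card {t \<in> T. R (hd cs) t}))"
    by (simp add: y)
qed (rule locally_finite_mset locally_finite_clique_index)+

text \<open>
  Both sides are sums over a coloring and a set \<open>V\<close> of \<open>a + 1\<close> colors, where on
  the left \<open>V\<close> is the set of colors of the clique containing the path vertex.  The
  weights agree for each \<open>V\<close> by \<open>sum_q_rank_except\<close>.
\<close>

lemma clique_gen_path_step:
  assumes R: "strict_total R" and "as \<noteq> []"
  shows "clique_gen R a (1 # as) =
    clique_gen R (Suc a) as + mps_const (q * qint a) * esym (Suc a) * word_gen R as"
proof -
  let ?B = "{cs. proper_word as cs} \<times> ksets (Suc a)"
  let ?mon = "\<lambda>(cs, T). mset cs + mset_set T :: nat multiset"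
  \<comment> \<open>The two parts of \<open>sum_q_rank_except\<close>: \<open>?u\<close> is
    supported on the pairs of \<open>clique_index (Suc a) as\<close>, and \<open>?v\<close> is
    independent of \<open>V\<close>, so its series factors with \<open>esym (Suc a)\<close>.\<close>
  let ?u = "\<lambda>(cs, V). if hd cs \<notin> V then q ^ (word_asc R as cs + card {t \<in> V. R (hd cs) t}) else 0"
  let ?v = "\<lambda>(cs, V :: nat set). (q * qint a) * q ^ word_asc R as cs"
  have "clique_gen R a (1 # as) = gen ?B ?mon (\<lambda>x. ?u x + ?v x)"
    unfolding clique_gen_def
  proof (rule gen_fibre [where h = "\<lambda>(cs, T). (tl cs, insert (hd cs) T)"])
    fix x assume "x \<in> clique_index a (1 # as)"
    then obtain c cs T where x: "x = (c # cs, T)" "proper_word (1 # as) (c # cs)" "T \<in> ksets a" "c \<notin> T"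
      by (rule clique_index_ConsE)
    then show "(case x of (cs, T) \<Rightarrow> (tl cs, insert (hd cs) T)) \<in> ?B \<and>
        ?mon (case x of (cs, T) \<Rightarrow> (tl cs, insert (hd cs) T)) = ?mon x"
      using finite_kset [OF x(3)] by (auto intro: insert_ksets)
  next
    fix y assume "y \<in> ?B"
    then obtain cs V where y: "y = (cs, V)" "proper_word as cs" "V \<in> ksets (Suc a)" by auto
    define k where "k = hd cs"
    have take: "take 1 cs = [k]"
      using proper_word_length [OF y(2)] assms(2) by (cases cs) (auto simp: k_def)
    have "(\<Sum>x | x \<in> clique_index a (1 # as) \<and> (case x of (cs, T) \<Rightarrow> (tl cs, insert (hd cs) T)) = y.
        case x of (cs, T) \<Rightarrow> q ^ (word_asc R (1 # as) cs + card {t \<in> T. R (hd cs) t})) =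
        (\<Sum>c\<in>V - {k}. q ^ word_asc R as cs *
          q ^ ((if R k c then 1 else 0) + card {t \<in> V. R c t}))"
    proof (rule sum.reindex_bij_witness [where
          i = "\<lambda>c. (c # cs, V - {c})" and j = "\<lambda>(cs, T). hd cs"])
      fix x assume "x \<in> {x. x \<in> clique_index a (1 # as) \<and>
          (case x of (cs, T) \<Rightarrow> (tl cs, insert (hd cs) T)) = y}"
      then have "x \<in> clique_index a (1 # as)" and
        hx: "(case x of (cs, T) \<Rightarrow> (tl cs, insert (hd cs) T)) = (cs, V)" using y by auto
      then obtain c ds T where "x = (c # ds, T)" "proper_word (1 # as) (c # ds)" "T \<in> ksets a"
          "c \<notin> T"
        by (elim clique_index_ConsE)
      with hx have x: "x = (c # cs, T)" "proper_word (1 # as) (c # cs)" "T \<in> ksets a"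
          "c \<notin> T" "V = insert c T" by auto
      then show "((case x of (cs, T) \<Rightarrow> hd cs) # cs, V - {case x of (cs, T) \<Rightarrow> hd cs}) = x"
        by auto
      show "(case x of (cs, T) \<Rightarrow> hd cs) \<in> V - {k}"
        using x take by auto
      have "{t \<in> V. R c t} = {t \<in> T. R c t}"
        using R x(5) by (auto simp: strict_total_def irreflp_def)
      then show "q ^ word_asc R as cs * q ^ ((if R k (case x of (cs, T) \<Rightarrow> hd cs) then 1 else 0) +
            card {t \<in> V. R (case x of (cs, T) \<Rightarrow> hd cs) t}) =
          (case x of (cs, T) \<Rightarrow> q ^ (word_asc R (1 # as) cs + card {t \<in> T. R (hd cs) t}))"
        using take x(1) by (simp add: power_add)
    next
      fix c assume c: "c \<in> V - {k}"
      then show "(case (c # cs, V - {c}) of (cs, T) \<Rightarrow> hd cs) = c" by simp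
      show "(c # cs, V - {c}) \<in> {x. x \<in> clique_index a (1 # as) \<and>
          (case x of (cs, T) \<Rightarrow> (tl cs, insert (hd cs) T)) = y}"
        using c take y kset_pos [OF y(3)] remove_ksets [OF _ y(3)] by (auto simp: clique_index_def)
    qed
    also have "\<dots> = q ^ word_asc R as cs *
        (q * qint a + (if k \<in> V then 0 else q ^ card {t \<in> V. R k t}))"
      using sum_q_rank_except [OF R finite_kset [OF y(3)] card_kset [OF y(3)]]
      by (simp flip: sum_distrib_left)
    also have "\<dots> = ?u y + ?v y"
      by (simp add: y k_def power_add algebra_simps)
    finally show "(\<Sum>x | x \<in> clique_index a (1 # as) \<and> (case x of (cs, T) \<Rightarrow> (tl cs, insert (hd cs) T)) = y.
        case x of (cs, T) \<Rightarrow> q ^ (word_asc R (1 # as) cs + card {t \<in> T. R (hd cs) t})) = ?u y + ?v y" .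
  qed (rule locally_finite_clique_index locally_finite_word_ksets)+
  also have "\<dots> = gen ?B ?mon ?u + gen ?B ?mon ?v"
    by (rule gen_add)
  also have "gen ?B ?mon ?u = clique_gen R (Suc a) as"
  proof -
    have eq: "clique_index (Suc a) as = {y \<in> ?B. case y of (cs, V) \<Rightarrow> hd cs \<notin> V}"
      by (auto simp: clique_index_def)
    show ?thesis
      unfolding clique_gen_def eq
      by (subst gen_filter [OF locally_finite_word_ksets]) (rule gen_cong, simp split: prod.split)
  qed
  also have "gen ?B ?mon ?v = mps_const (q * qint a) * (word_gen R as * esym (Suc a))"
    unfolding word_gen_def esym_eq_gen
    by (subst gen_mult [OF locally_finite_mset locally_finite_ksets], subst gen_const_mult [symmetric])
       (rule gen_cong, auto)
  finally show ?thesis by (simp add: mult_ac)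
qed

text \<open>The glued vertex may take any color of the full set, weighted by its rank. The result no
  longer mentions \<open>R\<close>, which is the source of the order independence of
  lollipops.\<close>

lemma clique_gen_single:
  assumes R: "strict_total R"
  shows "clique_gen R a [0] = mps_const (qint (Suc a)) * esym (Suc a)"
  unfolding clique_gen_def esym_eq_gen gen_const_mult [symmetric]
proof (rule gen_fibre [where h = "\<lambda>(cs, T). insert (hd cs) T"])
  fix x assume "x \<in> clique_index a [0]"
  then obtain c cs T where "x = (c # cs, T)" "proper_word [0] (c # cs)" "T \<in> ksets a" "c \<notin> T"
    by (rule clique_index_ConsE)
  then have x: "x = ([c], T)" "1 \<le> c" "T \<in> ksets a" "c \<notin> T"
    by (auto dest: proper_word_length)
  then show "(case x of (cs, T) \<Rightarrow> insert (hd cs) T) \<in> ksets (Suc a) \<and>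
      mset_set (case x of (cs, T) \<Rightarrow> insert (hd cs) T) = (case x of (cs, T) \<Rightarrow> mset cs + mset_set T)"
    using finite_kset [OF x(3)] by (auto intro: insert_ksets)
next
  fix V assume V: "V \<in> ksets (Suc a)"
  have "(\<Sum>x | x \<in> clique_index a [0] \<and> (case x of (cs, T) \<Rightarrow> insert (hd cs) T) = V.
      case x of (cs, T) \<Rightarrow> q ^ (word_asc R [0] cs + card {t \<in> T. R (hd cs) t})) =
      (\<Sum>c\<in>V. q ^ card {t \<in> V. R c t})"
  proof (rule sum.reindex_bij_witness [where i = "\<lambda>c. ([c], V - {c})" and j = "\<lambda>(cs, T). hd cs"])
    fix x assume "x \<in> {x. x \<in> clique_index a [0] \<and> (case x of (cs, T) \<Rightarrow> insert (hd cs) T) = V}"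
    then have "x \<in> clique_index a [0]" and hx: "(case x of (cs, T) \<Rightarrow> insert (hd cs) T) = V"
      by auto
    then obtain c cs T where x: "x = (c # cs, T)" "proper_word [0] (c # cs)" "T \<in> ksets a" "c \<notin> T"
      by (elim clique_index_ConsE)
    with hx have x: "x = ([c], T)" "T \<in> ksets a" "c \<notin> T" "V = insert c T"
      by (auto dest: proper_word_length)
    then show "([case x of (cs, T) \<Rightarrow> hd cs], V - {case x of (cs, T) \<Rightarrow> hd cs}) = x"
      and "(case x of (cs, T) \<Rightarrow> hd cs) \<in> V" by auto
    have "{t \<in> V. R c t} = {t \<in> T. R c t}"
      using R x(4) by (auto simp: strict_total_def irreflp_def)
    then show "q ^ card {t \<in> V. R (case x of (cs, T) \<Rightarrow> hd cs) t} =
        (case x of (cs, T) \<Rightarrow> q ^ (word_asc R [0] cs + card {t \<in> T. R (hd cs) t}))"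
      using x(1) by simp
  next
    fix c assume c: "c \<in> V"
    then show "(case ([c], V - {c}) of (cs, T) \<Rightarrow> hd cs) = c" by simp
    show "([c], V - {c}) \<in>
        {x. x \<in> clique_index a [0] \<and> (case x of (cs, T) \<Rightarrow> insert (hd cs) T) = V}"
      using c kset_pos [OF V] remove_ksets [OF c V] by (auto simp: clique_index_def)
  qed
  then show "(\<Sum>x | x \<in> clique_index a [0] \<and> (case x of (cs, T) \<Rightarrow> insert (hd cs) T) = V.
      case x of (cs, T) \<Rightarrow> q ^ (word_asc R [0] cs + card {t \<in> T. R (hd cs) t})) =
      qint (Suc a) * 1"
    using sum_q_rank [OF R finite_kset [OF V]] card_kset [OF V] by simp
qed (rule locally_finite_clique_index locally_finite_ksets)+

section \<open>Two cliques sharing a vertex\<close>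

text \<open>
  Telescoping: with \<open>H k\<close> the number of elements of \<open>W\<close> below \<open>k\<close> and of
  \<open>V\<close> from \<open>k\<close> on, \<open>H\<close> steps down by one at elements of \<open>V - W\<close> and up
  by one at elements of \<open>W - V\<close>.
\<close>

lemma cut_identity:
  fixes W V :: "nat set"
  assumes fin: "finite W" "finite V" and le: "card W \<le> card V"
  defines "h \<equiv> \<lambda>c. card {w \<in> W. w < c} + card {v \<in> V. c < v}"
  shows "(\<Sum>c\<in>V - W. q ^ h c) = (\<Sum>c\<in>W - V. q ^ h c) + q ^ card W * qint (card V - card W)"
proof -
  obtain N where N: "W \<union> V \<subseteq> {..<N}"
    using fin finite_nat_iff_bounded [of "W \<union> V"] by auto
  define H where "H k = card {w \<in> W. w < k} + card {v \<in> V. k \<le> v}" for k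
  define f where "f c = (if c \<in> V - W then q ^ h c else 0) - (if c \<in> W - V then q ^ h c else 0)" for c
  have W: "card {w \<in> W. w < Suc c} = card {w \<in> W. w < c} + (if c \<in> W then 1 else 0)" for c
  proof -
    have "{w \<in> W. w < Suc c} = (if c \<in> W then insert c {w \<in> W. w < c} else {w \<in> W. w < c})"
      by (auto simp: less_Suc_eq)
    with fin show ?thesis by simp
  qed
  have V: "card {v \<in> V. c \<le> v} = card {v \<in> V. c < v} + (if c \<in> V then 1 else 0)" for c
  proof -
    have "{v \<in> V. c \<le> v} = (if c \<in> V then insert c {v \<in> V. c < v} else {v \<in> V. c < v})"
      by (auto simp: le_less)
    with fin show ?thesis by simp
  qed
  \<comment> \<open>An element of \<open>V - W\<close> lowers \<open>H\<close> from
    \<open>h c + 1\<close> to \<open>h c\<close>, one of \<open>W - V\<close> raises it from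
    \<open>h c\<close> to \<open>h c + 1\<close>; an element of both or of neither leaves
    \<open>H\<close> unchanged, in accordance with \<open>f c = 0\<close>.\<close>
  have step: "(q - 1) * f c = q ^ H c - q ^ H (Suc c)" for c
    unfolding H_def W V f_def h_def Suc_le_eq by (auto simp: algebra_simps power_add)
  have "(q - 1) * (\<Sum>c<N. f c) = (\<Sum>c<N. q ^ H c - q ^ H (Suc c))"
    by (simp add: sum_distrib_left step)
  also have "\<dots> = q ^ H 0 - q ^ H N"
    by (rule sum_lessThan_telescope')
  also have "H 0 = card V" by (simp add: H_def)
  also have "H N = card W"
  proof -
    have "{w \<in> W. w < N} = W" and "{v \<in> V. N \<le> v} = {}" using N by auto
    then show ?thesis by (simp only: H_def card.empty add_0_right)
  qed
  also have "q ^ card V - q ^ card W = (q - 1) * (q ^ card W * qint (card V - card W))"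
  proof -
    have "q ^ card V = q ^ card W * q ^ (card V - card W)"
      using le by (simp flip: power_add)
    then have "q ^ card V - q ^ card W = q ^ card W * ((q - 1) * qint (card V - card W))"
      by (simp add: q_minus_1_qint right_diff_distrib)
    then show ?thesis
      by (simp only: mult.left_commute)
  qed
  finally have "(q - 1) * (\<Sum>c<N. f c) = (q - 1) * (q ^ card W * qint (card V - card W))" .
  moreover have "q - 1 \<noteq> 0" by (simp add: q_def one_pCons)
  ultimately have "(\<Sum>c<N. f c) = q ^ card W * qint (card V - card W)"
    by (simp only: mult_cancel_left) simp
  moreover have "(\<Sum>c<N. f c) = (\<Sum>c\<in>V - W. q ^ h c) - (\<Sum>c\<in>W - V. q ^ h c)"
  proof -
    have "{..<N} \<inter> (V - W) = V - W" "{..<N} \<inter> (W - V) = W - V" using N by auto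
    then show ?thesis
      unfolding f_def sum_subtractf
      by (simp only: sum.If_cases [OF finite_lessThan] Collect_mem_eq sum.neutral_const add_0_right)
  qed
  ultimately show ?thesis by (simp add: algebra_simps)
qed

text \<open>\<open>S\<close> and \<open>T\<close> hold the other colors of the two cliques that
  share the vertex of color \<open>c\<close>. They may overlap, as no edge joins the two
  sides.\<close>

definition bowtie_index :: "nat \<Rightarrow> nat \<Rightarrow> (nat set \<times> nat \<times> nat set) set" where
  "bowtie_index a b =
     {(S, c, T). S \<in> ksets a \<and> T \<in> ksets b \<and> 1 \<le> c \<and> c \<notin> S \<and> c \<notin> T}"

definition bowtie_gen :: "nat \<Rightarrow> nat \<Rightarrow> int poly mps" where
  "bowtie_gen a b = gen (bowtie_index a b) (\<lambda>(S, c, T). mset_set S + {#c#} + mset_set T)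
     (\<lambda>(S, c, T). q ^ (card {s \<in> S. s < c} + card {t \<in> T. c < t}))"

lemma locally_finite_bowtie:
  "locally_finite (bowtie_index a b) (\<lambda>(S, c, T). mset_set S + {#c#} + mset_set T)"
  unfolding locally_finite_def
proof
  fix M
  have "{x \<in> bowtie_index a b. (case x of (S, c, T) \<Rightarrow> mset_set S + {#c#} + mset_set T) = M}
      \<subseteq> Pow (set_mset M) \<times> set_mset M \<times> Pow (set_mset M)"
    by (auto simp: bowtie_index_def dest: finite_kset)
  then show "finite {x \<in> bowtie_index a b.
      (case x of (S, c, T) \<Rightarrow> mset_set S + {#c#} + mset_set T) = M}"
    by (rule finite_subset) simp
qed

lemma locally_finite_ksets_pair:
  "locally_finite (ksets a \<times> ksets b) (\<lambda>(W, V). mset_set W + mset_set V)"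
  by (intro locally_finite_Times locally_finite_ksets)

text \<open>
  The color \<open>c\<close> of the shared vertex can be added to the colors of either clique; comparing
  the two sums over the same pairs \<open>(W, V)\<close> gives a recursion in \<open>a\<close>.
\<close>

lemma bowtie_gen_right:
  "bowtie_gen a b = gen (ksets a \<times> ksets (Suc b)) (\<lambda>(W, V). mset_set W + mset_set V)
     (\<lambda>(W, V). \<Sum>c\<in>V - W. q ^ (card {w \<in> W. w < c} + card {v \<in> V. c < v}))"
  unfolding bowtie_gen_def
proof (rule gen_fibre [where h = "\<lambda>(S, c, T). (S, insert c T)"])
  fix x assume "x \<in> bowtie_index a b"
  then show "(case x of (S, c, T) \<Rightarrow> (S, insert c T)) \<in> ksets a \<times> ksets (Suc b) \<and>
      (case (case x of (S, c, T) \<Rightarrow> (S, insert c T)) of (W, V) \<Rightarrow> mset_set W + mset_set V) =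
      (case x of (S, c, T) \<Rightarrow> mset_set S + {#c#} + mset_set T)"
    by (auto simp: bowtie_index_def finite_kset intro: insert_ksets)
next
  fix y assume "y \<in> ksets a \<times> ksets (Suc b)"
  then obtain W V where y: "y = (W, V)" "W \<in> ksets a" "V \<in> ksets (Suc b)" by auto
  have "(\<Sum>x | x \<in> bowtie_index a b \<and> (case x of (S, c, T) \<Rightarrow> (S, insert c T)) = y.
      case x of (S, c, T) \<Rightarrow> q ^ (card {s \<in> S. s < c} + card {t \<in> T. c < t})) =
      (\<Sum>c\<in>V - W. q ^ (card {w \<in> W. w < c} + card {v \<in> V. c < v}))"
  proof (rule sum.reindex_bij_witness [where i = "\<lambda>c. (W, c, V - {c})" and j = "\<lambda>(S, c, T). c"])
    fix c assume c: "c \<in> V - W"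
    then show "(W, c, V - {c}) \<in>
        {x. x \<in> bowtie_index a b \<and> (case x of (S, c, T) \<Rightarrow> (S, insert c T)) = y}"
      using y kset_pos [OF y(3)] remove_ksets [OF _ y(3)] by (auto simp: bowtie_index_def)
  next
    fix x assume "x \<in> {x. x \<in> bowtie_index a b \<and> (case x of (S, c, T) \<Rightarrow> (S, insert c T)) = y}"
    then obtain c T where x: "x = (W, c, T)" "V = insert c T" "c \<notin> T" "c \<notin> W"
      by (auto simp: bowtie_index_def y)
    have "{v \<in> V. c < v} = {t \<in> T. c < t}" using x(2) by auto
    then show "q ^ (card {w \<in> W. w < (case x of (S, c, T) \<Rightarrow> c)} +
        card {v \<in> V. (case x of (S, c, T) \<Rightarrow> c) < v}) =
        (case x of (S, c, T) \<Rightarrow> q ^ (card {s \<in> S. s < c} + card {t \<in> T. c < t}))"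
      using x(1) by simp
    show "(W, case x of (S, c, T) \<Rightarrow> c, V - {case x of (S, c, T) \<Rightarrow> c}) = x"
      "(case x of (S, c, T) \<Rightarrow> c) \<in> V - W" using x by auto
  qed simp
  then show "(\<Sum>x | x \<in> bowtie_index a b \<and> (case x of (S, c, T) \<Rightarrow> (S, insert c T)) = y.
      case x of (S, c, T) \<Rightarrow> q ^ (card {s \<in> S. s < c} + card {t \<in> T. c < t})) =
      (case y of (W, V) \<Rightarrow> \<Sum>c\<in>V - W. q ^ (card {w \<in> W. w < c} + card {v \<in> V. c < v}))"
    by (simp add: y)
qed (rule locally_finite_bowtie locally_finite_ksets_pair)+

lemma bowtie_gen_left:
  "bowtie_gen a b = gen (ksets (Suc a) \<times> ksets b) (\<lambda>(W, V). mset_set W + mset_set V)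
     (\<lambda>(W, V). \<Sum>c\<in>W - V. q ^ (card {w \<in> W. w < c} + card {v \<in> V. c < v}))"
  unfolding bowtie_gen_def
proof (rule gen_fibre [where h = "\<lambda>(S, c, T). (insert c S, T)"])
  fix x assume "x \<in> bowtie_index a b"
  then show "(case x of (S, c, T) \<Rightarrow> (insert c S, T)) \<in> ksets (Suc a) \<times> ksets b \<and>
      (case (case x of (S, c, T) \<Rightarrow> (insert c S, T)) of (W, V) \<Rightarrow> mset_set W + mset_set V) =
      (case x of (S, c, T) \<Rightarrow> mset_set S + {#c#} + mset_set T)"
    by (auto simp: bowtie_index_def finite_kset intro: insert_ksets)
next
  fix y assume "y \<in> ksets (Suc a) \<times> ksets b"
  then obtain W V where y: "y = (W, V)" "W \<in> ksets (Suc a)" "V \<in> ksets b" by auto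
  have "(\<Sum>x | x \<in> bowtie_index a b \<and> (case x of (S, c, T) \<Rightarrow> (insert c S, T)) = y.
      case x of (S, c, T) \<Rightarrow> q ^ (card {s \<in> S. s < c} + card {t \<in> T. c < t})) =
      (\<Sum>c\<in>W - V. q ^ (card {w \<in> W. w < c} + card {v \<in> V. c < v}))"
  proof (rule sum.reindex_bij_witness [where i = "\<lambda>c. (W - {c}, c, V)" and j = "\<lambda>(S, c, T). c"])
    fix c assume c: "c \<in> W - V"
    then show "(W - {c}, c, V) \<in>
        {x. x \<in> bowtie_index a b \<and> (case x of (S, c, T) \<Rightarrow> (insert c S, T)) = y}"
      using y kset_pos [OF y(2)] remove_ksets [OF _ y(2)] by (auto simp: bowtie_index_def)
  next
    fix x assume "x \<in> {x. x \<in> bowtie_index a b \<and> (case x of (S, c, T) \<Rightarrow> (insert c S, T)) = y}"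
    then obtain S c where x: "x = (S, c, V)" "W = insert c S" "c \<notin> S" "c \<notin> V"
      by (auto simp: bowtie_index_def y)
    have "{w \<in> W. w < c} = {s \<in> S. s < c}" using x(2) by auto
    then show "q ^ (card {w \<in> W. w < (case x of (S, c, T) \<Rightarrow> c)} +
        card {v \<in> V. (case x of (S, c, T) \<Rightarrow> c) < v}) =
        (case x of (S, c, T) \<Rightarrow> q ^ (card {s \<in> S. s < c} + card {t \<in> T. c < t}))"
      using x(1) by simp
    show "(W - {case x of (S, c, T) \<Rightarrow> c}, case x of (S, c, T) \<Rightarrow> c, V) = x"
      "(case x of (S, c, T) \<Rightarrow> c) \<in> W - V" using x by auto
  qed simp
  then show "(\<Sum>x | x \<in> bowtie_index a b \<and> (case x of (S, c, T) \<Rightarrow> (insert c S, T)) = y.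
      case x of (S, c, T) \<Rightarrow> q ^ (card {s \<in> S. s < c} + card {t \<in> T. c < t})) =
      (case y of (W, V) \<Rightarrow> \<Sum>c\<in>W - V. q ^ (card {w \<in> W. w < c} + card {v \<in> V. c < v}))"
    by (simp add: y)
qed (rule locally_finite_bowtie locally_finite_ksets_pair)+

lemma ksets_0: "ksets 0 = {{}}"
  by (auto simp: ksets_def)

lemma gen_ksets_pair:
  "gen (ksets a \<times> ksets b) (\<lambda>(W, V). mset_set W + mset_set V) (\<lambda>_. c) =
    mps_const c * (esym b * esym a)"
proof -
  have "gen (ksets a \<times> ksets b) (\<lambda>(W, V). mset_set W + mset_set V) (\<lambda>_. c * 1) =
      mps_const c * (esym a * esym b)"
    unfolding esym_eq_gen gen_const_mult
    by (subst gen_mult) (auto intro: locally_finite_ksets simp: case_prod_unfold)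
  then show ?thesis by (simp add: mult.commute)
qed

lemma bowtie_gen_0: "bowtie_gen 0 b = mps_const (qint (Suc b)) * (esym (Suc b) * esym 0)"
  unfolding bowtie_gen_right gen_ksets_pair [symmetric]
proof (rule gen_cong)
  fix x assume "x \<in> ksets 0 \<times> ksets (Suc b)"
  then obtain V where "x = ({}, V)" and V: "V \<in> ksets (Suc b)"
    by (cases x) (simp add: ksets_0)
  note this(1) finite_kset [OF V] card_kset [OF V]
  then show "(case x of (W, V) \<Rightarrow>
      \<Sum>c\<in>V - W. q ^ (card {w \<in> W. w < c} + card {v \<in> V. c < v})) = qint (Suc b)"
    using sum_q_rank [OF strict_total_less, of V] by simp
qed

text \<open>The two bowties, written by their right and left forms, are sums over the same pairs of
  sets. By \<open>cut_identity\<close> their weights differ by an amount that is the same for all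
  pairs, so the error is a plain product of two elementary symmetric functions.\<close>

lemma bowtie_gen_Suc:
  assumes "a \<le> b"
  shows "bowtie_gen (Suc a) b = bowtie_gen a (Suc b) +
    mps_const (q ^ Suc a * qint (b - a)) * (esym (Suc b) * esym (Suc a))"
  unfolding bowtie_gen_right [of "Suc a"] bowtie_gen_left [of a "Suc b"]
    gen_ksets_pair [symmetric] gen_add [symmetric]
proof (rule gen_cong)
  fix x assume "x \<in> ksets (Suc a) \<times> ksets (Suc b)"
  then obtain W V where "x = (W, V)" and W: "W \<in> ksets (Suc a)" and V: "V \<in> ksets (Suc b)"
    by (cases x) simp
  note this(1) finite_kset [OF W] finite_kset [OF V] card_kset [OF W] card_kset [OF V]
  then show "(case x of (W, V) \<Rightarrow> \<Sum>c\<in>V - W. q ^ (card {w \<in> W. w < c} + card {v \<in> V. c < v})) =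
      (case x of (W, V) \<Rightarrow> \<Sum>c\<in>W - V. q ^ (card {w \<in> W. w < c} + card {v \<in> V. c < v})) +
      q ^ Suc a * qint (b - a)"
    using cut_identity [of W V] assms by simp
qed

text \<open>Vertices move from the smaller clique to the larger one until the smaller is used up;
  the move from \<open>Suc a\<close> to \<open>a\<close> leaves behind the summand
  \<open>i = Suc a\<close>. The hypothesis keeps the compared sets in the order that
  \<open>cut_identity\<close> requires.\<close>

lemma bowtie_gen_eq:
  assumes "a \<le> Suc b"
  shows "bowtie_gen a b = (\<Sum>i\<le>a. mps_const (q ^ i * qint (a + b + 1 - 2 * i)) *
    (esym (a + b + 1 - i) * esym i))"
  using assms
proof (induction a arbitrary: b)
  case 0
  then show ?case by (simp add: bowtie_gen_0)
next
  case (Suc a)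
  have "a + b + 2 - 2 * Suc a = b - a" "a + b + 2 - Suc a = Suc b"
    using Suc.prems by auto
  then show ?case
    using Suc.IH [of "Suc b"] bowtie_gen_Suc [of a b] Suc.prems by simp
qed

text \<open>The head of the word is the shared vertex. The other \<open>a\<close> vertices of the
  lower clique meet it only through their set of colors, and their arrangements sum to
  \<open>qfact a\<close>.\<close>

lemma clique_gen_stair:
  "clique_gen (<) b (stair (Suc a)) = mps_const (qfact a) * bowtie_gen a b"
  unfolding clique_gen_def bowtie_gen_def gen_const_mult [symmetric]
proof (rule gen_fibre [where h = "\<lambda>(cs, T). (set (tl cs), hd cs, T)"])
  fix x assume "x \<in> clique_index b (stair (Suc a))"
  then obtain c cs T where x: "x = (c # cs, T)" "proper_word (a # stair a) (c # cs)" "T \<in> ksets b"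
      "c \<notin> T"
    by (auto elim: clique_index_ConsE)
  then have cs: "length cs = a" "distinct cs" "\<forall>t\<in>set cs. 1 \<le> t"
    by (auto simp: proper_word_stair)
  then have "card (set cs) = a" by (metis distinct_card)
  with cs x show "(case x of (cs, T) \<Rightarrow> (set (tl cs), hd cs, T)) \<in> bowtie_index a b \<and>
      (case (case x of (cs, T) \<Rightarrow> (set (tl cs), hd cs, T)) of
        (S, c, T) \<Rightarrow> mset_set S + {#c#} + mset_set T) = (case x of (cs, T) \<Rightarrow> mset cs + mset_set T)"
    by (auto simp: bowtie_index_def ksets_def mset_set_set)
next
  fix y assume "y \<in> bowtie_index a b"
  then obtain S c T where y: "y = (S, c, T)" "S \<in> ksets a" "T \<in> ksets b" "1 \<le> c" "c \<notin> S" "c \<notin> T"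
    by (auto simp: bowtie_index_def)
  have ts: "length ts = a" "distinct ts" "set ts = S" if "ts \<in> permutations_of_set S" for ts
    using that card_kset [OF y(2)] by (auto simp: permutations_of_set_def distinct_card)
  have asc: "word_asc (<) (stair (Suc a)) (c # ts) = card {s \<in> S. s < c} + word_asc (<) (stair a) ts"
    if "ts \<in> permutations_of_set S" for ts
  proof -
    have "set (filter (\<lambda>x. x < c) ts) = {s \<in> S. s < c}" using ts [OF that] by auto
    then have "length (filter (\<lambda>x. x < c) ts) = card {s \<in> S. s < c}"
      using ts [OF that] by (metis distinct_card distinct_filter)
    then show ?thesis using ts [OF that] by simp
  qed
  have "(\<Sum>x | x \<in> clique_index b (stair (Suc a)) \<and> (case x of (cs, T) \<Rightarrow> (set (tl cs), hd cs, T)) = y.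
      case x of (cs, T) \<Rightarrow> q ^ (word_asc (<) (stair (Suc a)) cs + card {t \<in> T. hd cs < t})) =
      (\<Sum>ts\<in>permutations_of_set S.
        q ^ (card {s \<in> S. s < c} + card {t \<in> T. c < t}) * q ^ word_asc (<) (stair (card S)) ts)"
  proof (rule sum.reindex_bij_witness [where i = "\<lambda>ts. (c # ts, T)" and j = "\<lambda>(cs, T). tl cs"])
    fix ts assume t: "ts \<in> permutations_of_set S"
    have "proper_word (stair (Suc a)) (c # ts)"
      using ts [OF t] y kset_pos [OF y(2)] by (simp add: proper_word_stair)
    then show "(c # ts, T) \<in> {x. x \<in> clique_index b (stair (Suc a)) \<and>
        (case x of (cs, T) \<Rightarrow> (set (tl cs), hd cs, T)) = y}"
      using y ts [OF t] by (simp add: clique_index_def)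
  next
    fix x assume "x \<in> {x. x \<in> clique_index b (stair (Suc a)) \<and>
        (case x of (cs, T) \<Rightarrow> (set (tl cs), hd cs, T)) = y}"
    then have x: "x \<in> clique_index b (a # stair a)"
      and hx: "(case x of (cs, T) \<Rightarrow> (set (tl cs), hd cs, T)) = (S, c, T)" using y by auto
    from x obtain c' ts T' where "x = (c' # ts, T')" "proper_word (a # stair a) (c' # ts)"
      by (elim clique_index_ConsE)
    with hx have x: "x = (c # ts, T)" "distinct ts" "set ts = S"
      by (auto simp: proper_word_stair)
    then have t: "ts \<in> permutations_of_set S" by (simp add: permutations_of_set_def)
    then show "(case x of (cs, T) \<Rightarrow> tl cs) \<in> permutations_of_set S"
      and "(c # (case x of (cs, T) \<Rightarrow> tl cs), T) = x" using x by auto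
    show "q ^ (card {s \<in> S. s < c} + card {t \<in> T. c < t}) *
        q ^ word_asc (<) (stair (card S)) (case x of (cs, T) \<Rightarrow> tl cs) =
        (case x of (cs, T) \<Rightarrow> q ^ (word_asc (<) (stair (Suc a)) cs + card {t \<in> T. hd cs < t}))"
      unfolding x(1) prod.case list.sel asc [OF t] card_kset [OF y(2)]
      by (simp add: power_add)
  qed simp
  also have "\<dots> = qfact a * q ^ (card {s \<in> S. s < c} + card {t \<in> T. c < t})"
    using sum_permutations_of_set [OF strict_total_less finite_kset [OF y(2)]] card_kset [OF y(2)]
    by (simp flip: sum_distrib_left)
  finally show "(\<Sum>x | x \<in> clique_index b (stair (Suc a)) \<and>
      (case x of (cs, T) \<Rightarrow> (set (tl cs), hd cs, T)) = y.
      case x of (cs, T) \<Rightarrow> q ^ (word_asc (<) (stair (Suc a)) cs + card {t \<in> T. hd cs < t})) =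
      qfact a * (case y of (S, c, T) \<Rightarrow> q ^ (card {s \<in> S. s < c} + card {t \<in> T. c < t}))"
    by (simp add: y)
qed (rule locally_finite_bowtie locally_finite_clique_index)+

text \<open>Every application of the step moves one path vertex into the clique. When
  \<open>j\<close> path edges remain, \<open>a\<close> has become \<open>a + n - 1 - j\<close>,
  whence the indices of the summand.\<close>

lemma clique_gen_path:
  assumes R: "strict_total R" and "as \<noteq> []"
  shows "clique_gen R a (replicate n 1 @ as) = clique_gen R (a + n) as +
    (\<Sum>j<n. mps_const (q * qint (a + n - 1 - j)) * esym (a + n - j) * word_gen R (replicate j 1 @ as))"
proof (induction n arbitrary: a)
  case 0
  then show ?case by simp
next
  case (Suc n)
  have "clique_gen R a (replicate (Suc n) 1 @ as) =
      clique_gen R (Suc a) (replicate n 1 @ as) +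
      mps_const (q * qint a) * esym (Suc a) * word_gen R (replicate n 1 @ as)"
    using clique_gen_path_step [OF R, of "replicate n 1 @ as" a] assms(2) by simp
  then show ?case using Suc.IH [of "Suc a"] by (simp add: algebra_simps)
qed

section \<open>Graphs and back-degree sequences\<close>

text \<open>The edges as pairs of positions in a word; position \<open>i\<close> is the vertex \<open>length as - i\<close>.\<close>

definition back_pairs :: "nat list \<Rightarrow> (nat \<times> nat) set" where
  "back_pairs as = {(i, j). i < j \<and> j < length as \<and> j \<le> i + as ! i}"

lemma finite_back_pairs: "finite (back_pairs as)"
  by (rule finite_subset [of _ "{..<length as} \<times> {..<length as}"]) (auto simp: back_pairs_def)

text \<open>Splitting off the edges at position 0 imitates the recursion of
  \<open>proper_word\<close> and \<open>word_asc\<close>, so both can be translated to edges by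
  induction.\<close>

lemma back_pairs_Cons:
  "back_pairs (a # as) = Pair 0 ` {j. 0 < j \<and> j \<le> a \<and> j \<le> length as} \<union> map_prod Suc Suc ` back_pairs as"
  (is "_ = ?A \<union> ?B")
proof (intro set_eqI iffI)
  fix p assume p: "p \<in> back_pairs (a # as)"
  obtain i j where ij: "p = (i, j)" by (cases p)
  show "p \<in> ?A \<union> ?B"
  proof (cases i)
    case 0
    with p ij show ?thesis by (auto simp: back_pairs_def)
  next
    case (Suc i')
    with p ij obtain j' where "j = Suc j'" by (cases j) (auto simp: back_pairs_def)
    with p ij Suc have "(i', j') \<in> back_pairs as" and "p = map_prod Suc Suc (i', j')"
      by (auto simp: back_pairs_def)
    then show ?thesis by blast
  qed
qed (auto simp: back_pairs_def)

lemma proper_word_iff: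
  "proper_word as cs \<longleftrightarrow> length cs = length as \<and> (\<forall>c\<in>set cs. 1 \<le> c) \<and>
    (\<forall>(i, j)\<in>back_pairs as. cs ! i \<noteq> cs ! j)"
proof (induction as cs rule: proper_word.induct)
  case (2 a as c cs)
  have "c \<notin> set (take a cs) \<longleftrightarrow> (\<forall>j\<in>{j. 0 < j \<and> j \<le> a \<and> j \<le> length as}. c \<noteq> (c # cs) ! j)"
    if "length cs = length as"
  proof -
    have "c \<in> set (take a cs) \<longleftrightarrow> (\<exists>j<length as. j < a \<and> cs ! j = c)"
      using that by (auto simp: in_set_conv_nth)
    also have "\<dots> \<longleftrightarrow> (\<exists>j\<in>{j. 0 < j \<and> j \<le> a \<and> j \<le> length as}. c = (c # cs) ! j)"
    proof
      assume "\<exists>j<length as. j < a \<and> cs ! j = c"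
      then obtain j where "j < length as" "j < a" "cs ! j = c" by blast
      then show "\<exists>j\<in>{j. 0 < j \<and> j \<le> a \<and> j \<le> length as}. c = (c # cs) ! j"
        by (intro bexI [of _ "Suc j"]) auto
    next
      assume "\<exists>j\<in>{j. 0 < j \<and> j \<le> a \<and> j \<le> length as}. c = (c # cs) ! j"
      then obtain j where "0 < j" "j \<le> a" "j \<le> length as" "c = (c # cs) ! j" by blast
      then show "\<exists>j<length as. j < a \<and> cs ! j = c"
        by (intro exI [of _ "j - 1"]) auto
    qed
    finally show ?thesis by blast
  qed
  moreover have "(\<forall>(i, j)\<in>back_pairs (a # as). (c # cs) ! i \<noteq> (c # cs) ! j) \<longleftrightarrow>
      (\<forall>j\<in>{j. 0 < j \<and> j \<le> a \<and> j \<le> length as}. c \<noteq> (c # cs) ! j) \<and>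
      (\<forall>(i, j)\<in>back_pairs as. cs ! i \<noteq> cs ! j)"
    unfolding back_pairs_Cons ball_Un by (simp add: case_prod_unfold)
  ultimately show ?case
    unfolding proper_word.simps 2 by auto
qed (auto simp: back_pairs_def)

lemma word_asc_eq_card:
  "length cs = length as \<Longrightarrow>
    word_asc R as cs = card {(i, j). (i, j) \<in> back_pairs as \<and> R (cs ! j) (cs ! i)}"
proof (induction R as cs rule: word_asc.induct)
  case (1 R a as c cs)
  let ?A = "{j. 0 < j \<and> j \<le> a \<and> j \<le> length as \<and> R ((c # cs) ! j) c}"
  let ?B = "{(i, j). (i, j) \<in> back_pairs as \<and> R (cs ! j) (cs ! i)}"
  have "{(i, j). (i, j) \<in> back_pairs (a # as) \<and> R ((c # cs) ! j) ((c # cs) ! i)} =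
      Pair 0 ` ?A \<union> map_prod Suc Suc ` ?B"
    by (auto simp: back_pairs_Cons)
  moreover have "card (Pair 0 ` ?A \<union> map_prod Suc Suc ` ?B) = card (Pair (0::nat) ` ?A) + card (map_prod Suc Suc ` ?B)"
    by (rule card_Un_disjoint) (auto intro: finite_subset [OF _ finite_back_pairs [of as]])
  moreover have "card (Pair (0::nat) ` ?A) = card ?A"
    by (rule card_image) (auto simp: inj_on_def)
  moreover have "card (map_prod Suc Suc ` ?B) = card ?B"
    by (rule card_image) (auto simp: inj_on_def)
  moreover have "card ?A = length (filter (\<lambda>x. R x c) (take a cs))"
  proof -
    have "?A = Suc ` {i. i < length (take a cs) \<and> R (take a cs ! i) c}"
    proof (intro set_eqI iffI)
      fix j assume "j \<in> ?A"
      then show "j \<in> Suc ` {i. i < length (take a cs) \<and> R (take a cs ! i) c}"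
        using 1(2) by (intro image_eqI [of _ _ "j - 1"]) auto
    qed (use 1(2) in auto)
    then show ?thesis
      by (simp add: length_filter_conv_card card_image)
  qed
  ultimately show ?case using 1 by simp
qed (auto simp: back_pairs_def)

text \<open>Reversing a word keeps the same edges in mirrored positions. Properness is symmetric in
  the two ends of an edge, but the ends change sides in the ascent count, so the order becomes its
  converse.\<close>

lemma word_gen_rev:
  assumes len: "length bs = length as"
    and bp: "back_pairs bs = (\<lambda>(i, j). (length as - 1 - j, length as - 1 - i)) ` back_pairs as"
  shows "word_gen R as = word_gen (\<lambda>x y. R y x) bs"
proof -
  define f where "f = (\<lambda>(i, j). (length as - 1 - j, length as - 1 - i))"
  have lt: "i < length as" "j < length as" if "(i, j) \<in> back_pairs as" for i j
    using that by (auto simp: back_pairs_def)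
  have inj: "inj_on f (back_pairs as)"
  proof (rule inj_onI)
    fix x y assume "x \<in> back_pairs as" "y \<in> back_pairs as" "f x = f y"
    then show "x = y"
      using lt [of "fst x" "snd x"] lt [of "fst y" "snd y"]
      by (cases x, cases y) (auto simp: f_def)
  qed
  have rev_f: "rev cs ! fst (f p) = cs ! snd p" "rev cs ! snd (f p) = cs ! fst p"
    if "p \<in> back_pairs as" "length cs = length as" for p and cs :: "nat list"
    using that lt [of "fst p" "snd p"] by (cases p; simp add: f_def rev_nth)+
  have "(\<forall>(i, j)\<in>f ` back_pairs as. rev cs ! i \<noteq> rev cs ! j) \<longleftrightarrow>
      (\<forall>(i, j)\<in>back_pairs as. cs ! i \<noteq> cs ! j)" if "length cs = length as" for cs :: "nat list"
    unfolding ball_simps case_prod_unfold using rev_f [OF _ that] by (metis (no_types, lifting))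
  then have proper: "proper_word bs (rev cs) \<longleftrightarrow> proper_word as cs" for cs
    unfolding proper_word_iff bp len f_def [symmetric] length_rev set_rev by blast
  have asc: "word_asc (\<lambda>x y. R y x) bs (rev cs) = word_asc R as cs" if "proper_word as cs" for cs
  proof -
    have l: "length cs = length as" by (rule proper_word_length) fact
    have "{(i, j). (i, j) \<in> f ` back_pairs as \<and> R (rev cs ! i) (rev cs ! j)} =
        f ` {(i, j). (i, j) \<in> back_pairs as \<and> R (cs ! j) (cs ! i)}" (is "?L = f ` ?S")
    proof -
      have "?L = f ` {p \<in> back_pairs as. R (rev cs ! fst (f p)) (rev cs ! snd (f p))}"
        by (auto simp: case_prod_unfold)
      also have "{p \<in> back_pairs as. R (rev cs ! fst (f p)) (rev cs ! snd (f p))} = ?S"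
        using rev_f [OF _ l] by (auto simp: case_prod_unfold)
      finally show ?thesis .
    qed
    moreover have "card (f ` ?S) = card ?S"
      by (rule card_image) (rule inj_on_subset [OF inj], auto)
    ultimately show ?thesis
      by (simp only: word_asc_eq_card length_rev l len bp f_def [symmetric])
  qed
  show ?thesis
    unfolding word_gen_def
  proof (rule gen_reindex [where h = rev])
    show "bij_betw rev {cs. proper_word as cs} {cs. proper_word bs cs}"
      by (rule bij_betwI [where g = rev]) (auto simp: proper proper [of "rev _", simplified])
  qed (auto simp: asc)
qed

text \<open>The sequence of $K_{b+1} + L_{a+1,n}$.\<close>

definition dumbbell :: "nat \<Rightarrow> nat \<Rightarrow> nat \<Rightarrow> nat list" where
  "dumbbell a n b = stair1 a @ replicate n 1 @ stair (Suc b)"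

lemma length_dumbbell: "length (dumbbell a n b) = a + n + Suc b"
  by (simp add: dumbbell_def)

lemma dumbbell_nth:
  "i < a + n + Suc b \<Longrightarrow>
    dumbbell a n b ! i = (if i < a then a - i else if i < a + n then 1 else a + n + b - i)"
  unfolding dumbbell_def by (auto simp: nth_append rev_nth simp del: upt_Suc)

text \<open>The disjuncts stand for the upper clique (with the glued vertex at position
  \<open>a\<close>), consecutive positions, and the lower clique. In this form the mirror map
  visibly exchanges \<open>a\<close> and \<open>b\<close>.\<close>

lemma back_pairs_dumbbell:
  "back_pairs (dumbbell a n b) =
    {(i, j). i < j \<and> j \<le> a + n + b \<and> (j \<le> a \<or> j = Suc i \<or> a + n \<le> i)}"
  unfolding back_pairs_def length_dumbbell by (auto simp: dumbbell_nth split: if_splits)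

lemma word_gen_dumbbell_rev: "word_gen R (dumbbell a n b) = word_gen (\<lambda>x y. R y x) (dumbbell b n a)"
proof (rule word_gen_rev)
  let ?f = "\<lambda>(i, j). (a + n + b - j, a + n + b - i)"
  show "back_pairs (dumbbell b n a) =
      (\<lambda>(i, j). (length (dumbbell a n b) - 1 - j, length (dumbbell a n b) - 1 - i)) ` back_pairs (dumbbell a n b)"
    (is "?L = ?R")
  proof (intro set_eqI iffI)
    fix p assume p: "p \<in> ?L"
    then show "p \<in> ?R"
      unfolding back_pairs_dumbbell length_dumbbell
      by (intro image_eqI [of _ _ "?f p"]) auto
  qed (auto simp: back_pairs_dumbbell length_dumbbell)
qed (simp add: length_dumbbell)

text \<open>The factors \<open>dumbbell 0 j b\<close> have their path above the clique, whereas a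
  lollipop has it below; they are the mirror images still to be identified.\<close>

lemma word_gen_dumbbell:
  assumes R: "strict_total R"
  shows "word_gen R (dumbbell a n b) = mps_const (qfact a) *
    (clique_gen R (a + n) (stair (Suc b)) +
     (\<Sum>j<n. mps_const (q * qint (a + n - 1 - j)) * esym (a + n - j) * word_gen R (dumbbell 0 j b)))"
proof -
  have dumbbell_0: "dumbbell 0 j b = replicate j 1 @ stair (Suc b)" for j by (simp add: dumbbell_def)
  have "word_gen R (dumbbell a n b) =
      mps_const (qfact a) * clique_gen R a (replicate n 1 @ stair (Suc b))"
    unfolding dumbbell_def by (rule word_gen_clique [OF R]) simp
  also have "clique_gen R a (replicate n 1 @ stair (Suc b)) = clique_gen R (a + n) (stair (Suc b)) +
      (\<Sum>j<n. mps_const (q * qint (a + n - 1 - j)) * esym (a + n - j) *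
        word_gen R (replicate j 1 @ stair (Suc b)))"
    by (rule clique_gen_path [OF R]) simp
  finally show ?thesis by (simp only: dumbbell_0)
qed

text \<open>
  The recursion does not depend on the order when the lower clique is a single vertex.  This
  replaces the symmetry of the chromatic quasisymmetric function in identifying a lollipop
  with its mirror image.
\<close>

lemma word_gen_dumbbell_order:
  assumes R: "strict_total R" and R': "strict_total R'"
  shows "word_gen R (dumbbell a n 0) = word_gen R' (dumbbell a n 0)"
proof (induction n arbitrary: a rule: less_induct)
  case (less n)
  have "stair (Suc 0) = [0]" by simp
  then show ?case
    unfolding word_gen_dumbbell [OF R, of a] word_gen_dumbbell [OF R', of a]
    by (simp only: clique_gen_single [OF R] clique_gen_single [OF R'])
       (simp add: less.IH [of _ 0])
qed

lemma word_gen_lollipop: "word_gen (<) (dumbbell 0 j b) = word_gen (<) (dumbbell b j 0)"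
  unfolding word_gen_dumbbell_rev [of "(<)" 0 j b]
  by (rule word_gen_dumbbell_order [OF strict_total_conversep [OF strict_total_less] strict_total_less])

section \<open>From graphs to words\<close>

lemma chrom_qsym_eq_gen:
  "chrom_qsym G = gen (proper_colorings G) (color_monomial G) (\<lambda>\<kappa>. q ^ asc G \<kappa>)"
  by (simp add: chrom_qsym_def gen_def)

definition edge_of_pair :: "nat \<Rightarrow> nat \<times> nat \<Rightarrow> nat set" where
  "edge_of_pair N = (\<lambda>(i, j). {N - i, N - j})"

lemma inj_edge_of_pair: "inj_on (edge_of_pair (length as)) (back_pairs as)"
proof (rule inj_onI)
  fix x y assume "x \<in> back_pairs as" "y \<in> back_pairs as"
    and eq: "edge_of_pair (length as) x = edge_of_pair (length as) y"
  moreover obtain i j k l where xy: "x = (i, j)" "y = (k, l)" by (cases x, cases y)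
  ultimately have "i < j" "j < length as" "k < l" "l < length as"
    and "{length as - i, length as - j} = {length as - k, length as - l}"
    by (auto simp: back_pairs_def edge_of_pair_def)
  then show "x = y" unfolding xy doubleton_eq_iff by auto
qed

text \<open>\<open>h\<close> reads a coloring from the largest vertex down, and \<open>g\<close>
  inverts it, restricting to the vertices because colorings are extensional. In a pair
  \<open>i < j\<close> the smaller vertex sits at the later position \<open>j\<close>, so an ascent
  means that the entry at \<open>j\<close> is less than the entry at \<open>i\<close>.\<close>

lemma chrom_qsym_eq_word_gen:
  assumes verts: "verts G = {1..length as}"
    and edges: "edges G = edge_of_pair (length as) ` back_pairs as"
  shows "chrom_qsym G = word_gen (<) as"
proof -
  let ?N = "length as"
  define h where "h \<kappa> = map \<kappa> (rev [1..<Suc ?N])" for \<kappa> :: "nat \<Rightarrow> nat"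
  define g where "g cs = restrict (\<lambda>v. cs ! (?N - v)) {1..?N}" for cs :: "nat list"
  have nth: "h \<kappa> ! i = \<kappa> (?N - i)" if "i < ?N" for \<kappa> i
    using that unfolding h_def by (simp add: rev_nth Suc_diff_Suc del: upt_Suc)
  have len: "length (h \<kappa>) = ?N" for \<kappa>
    by (simp add: h_def del: upt_Suc)
  have set_h: "set (h \<kappa>) = \<kappa> ` {1..?N}" for \<kappa>
    unfolding h_def set_map set_rev set_upt atLeastLessThanSuc_atLeastAtMost by (rule refl)
  have pairs: "i < ?N" "j < ?N" "i < j" if "(i, j) \<in> back_pairs as" for i j
    using that by (auto simp: back_pairs_def)
  have edge_iff: "(\<forall>u v. {u, v} \<in> edges G \<longrightarrow> u \<noteq> v \<longrightarrow> \<kappa> u \<noteq> \<kappa> v) \<longleftrightarrow>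
      (\<forall>(i, j)\<in>back_pairs as. \<kappa> (?N - i) \<noteq> \<kappa> (?N - j))" for \<kappa> :: "nat \<Rightarrow> nat"
  proof (intro iffI ballI)
    fix p assume *: "\<forall>u v. {u, v} \<in> edges G \<longrightarrow> u \<noteq> v \<longrightarrow> \<kappa> u \<noteq> \<kappa> v" and p: "p \<in> back_pairs as"
    obtain i j where ij: "p = (i, j)" by (cases p)
    then have "{?N - i, ?N - j} \<in> edges G"
      unfolding edges using p by (auto simp: edge_of_pair_def image_iff)
    moreover have "?N - i \<noteq> ?N - j" using pairs [of i j] p ij by auto
    ultimately show "case p of (i, j) \<Rightarrow> \<kappa> (?N - i) \<noteq> \<kappa> (?N - j)" using * ij by auto
  next
    assume *: "\<forall>(i, j)\<in>back_pairs as. \<kappa> (?N - i) \<noteq> \<kappa> (?N - j)"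
    show "\<forall>u v. {u, v} \<in> edges G \<longrightarrow> u \<noteq> v \<longrightarrow> \<kappa> u \<noteq> \<kappa> v"
    proof (intro allI impI)
      fix u v assume "{u, v} \<in> edges G"
      then obtain i j where "(i, j) \<in> back_pairs as" "{u, v} = {?N - i, ?N - j}"
        unfolding edges edge_of_pair_def by auto
      with * show "\<kappa> u \<noteq> \<kappa> v" by (auto simp: doubleton_eq_iff)
    qed
  qed
  have proper: "proper_word as (h \<kappa>) \<longleftrightarrow> (\<forall>v\<in>{1..?N}. 1 \<le> \<kappa> v) \<and>
      (\<forall>u v. {u, v} \<in> edges G \<longrightarrow> u \<noteq> v \<longrightarrow> \<kappa> u \<noteq> \<kappa> v)" for \<kappa>
    unfolding edge_iff proper_word_iff set_h len
    by (auto simp: nth pairs)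
  have gh: "g (h \<kappa>) = \<kappa>" if "\<kappa> \<in> proper_colorings G" for \<kappa>
  proof
    fix v
    show "g (h \<kappa>) v = \<kappa> v"
    proof (cases "v \<in> {1..?N}")
      case True
      then have "?N - v < ?N" by auto
      with True show ?thesis using nth [of "?N - v" \<kappa>] by (simp add: g_def)
    next
      case False
      then show ?thesis
        using that by (auto simp: g_def proper_colorings_def verts PiE_iff extensional_def)
    qed
  qed
  have hg: "h (g cs) = cs" if "length cs = ?N" for cs
    by (rule nth_equalityI) (use that in \<open>auto simp: len nth g_def\<close>)
  have asc: "word_asc (<) as (h \<kappa>) = asc G \<kappa>" for \<kappa>
  proof -
    have "{e \<in> edges G. \<exists>u v. e = {u, v} \<and> u < v \<and> \<kappa> u < \<kappa> v} =
        edge_of_pair ?N ` {(i, j). (i, j) \<in> back_pairs as \<and> h \<kappa> ! j < h \<kappa> ! i}" (is "?E = _ ` ?P")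
    proof (intro set_eqI iffI)
      fix e assume e: "e \<in> ?E"
      then obtain i j where ij: "(i, j) \<in> back_pairs as" "e = {?N - i, ?N - j}"
        unfolding edges edge_of_pair_def by auto
      from e obtain u v where uv: "e = {u, v}" "u < v" "\<kappa> u < \<kappa> v" by auto
      have "?N - j < ?N - i" using pairs [OF ij(1)] by auto
      with ij uv have "u = ?N - j" "v = ?N - i" by (auto simp: doubleton_eq_iff)
      with uv ij pairs [OF ij(1)] show "e \<in> edge_of_pair ?N ` ?P"
        by (intro image_eqI [of _ _ "(i, j)"]) (auto simp: edge_of_pair_def nth)
    next
      fix e assume "e \<in> edge_of_pair ?N ` ?P"
      then obtain i j where ij: "(i, j) \<in> back_pairs as" "e = {?N - i, ?N - j}"
          "h \<kappa> ! j < h \<kappa> ! i"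
        unfolding edge_of_pair_def by auto
      then have "e = {?N - j, ?N - i}" "?N - j < ?N - i" "\<kappa> (?N - j) < \<kappa> (?N - i)"
        using pairs [OF ij(1)] by (auto simp: nth)
      moreover have "e \<in> edges G" using ij unfolding edges edge_of_pair_def by auto
      ultimately show "e \<in> ?E" by blast
    qed
    moreover have "card (edge_of_pair ?N ` ?P) = card ?P"
      by (rule card_image) (rule inj_on_subset [OF inj_edge_of_pair], auto)
    ultimately show ?thesis
      unfolding asc_def by (simp add: word_asc_eq_card len)
  qed
  show ?thesis
    unfolding chrom_qsym_eq_gen word_gen_def
  proof (rule gen_reindex [where h = h])
    show "bij_betw h (proper_colorings G) {cs. proper_word as cs}"
    proof (rule bij_betwI [where g = g])
      show "h \<in> proper_colorings G \<rightarrow> {cs. proper_word as cs}"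
        by (auto simp: proper proper_colorings_def verts PiE_iff)
      show "g \<in> {cs. proper_word as cs} \<rightarrow> proper_colorings G"
      proof
        fix cs assume cs: "cs \<in> {cs. proper_word as cs}"
        then have "proper_word as (h (g cs))"
          by (simp add: hg proper_word_length)
        then show "g cs \<in> proper_colorings G"
          unfolding proper by (auto simp: proper_colorings_def verts g_def PiE_iff)
      qed
    qed (auto simp: gh hg proper_word_length)
    show "mset (h \<kappa>) = color_monomial G \<kappa>" for \<kappa>
      unfolding h_def color_monomial_def verts mset_map mset_rev mset_upt
        atLeastLessThanSuc_atLeastAtMost by (rule refl)
  qed (simp add: asc)
qed

lemma edges_K_plus_lollipop:
  "edges (K_plus_lollipop (Suc b) (Suc a) n) = edge_of_pair (length (dumbbell a n b)) ` back_pairs (dumbbell a n b)"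
  (is "?L = ?R")
proof (intro set_eqI iffI)
  have R: "{u, v} \<in> ?R" if "1 \<le> u" "u < v" "v \<le> a + n + Suc b"
      "v \<le> Suc b \<or> v = Suc u \<or> Suc (b + n) \<le> u" for u v
    using that unfolding back_pairs_dumbbell length_dumbbell edge_of_pair_def
    by (intro image_eqI [of _ _ "(a + n + Suc b - v, a + n + Suc b - u)"]) auto
  have R': "{u, v} \<in> ?R" if "1 \<le> u" "1 \<le> v" "u \<noteq> v" "u \<le> a + n + Suc b" "v \<le> a + n + Suc b"
      "u \<le> Suc b \<and> v \<le> Suc b \<or> Suc (b + n) \<le> u \<and> Suc (b + n) \<le> v" for u v
    using R [of u v] R [of v u] that by (cases "u < v") (auto simp: insert_commute)
  fix e assume "e \<in> ?L"
  then consider (low) u v where "e = {u, v}" "u \<noteq> v" "u \<in> {1..Suc b}" "v \<in> {1..Suc b}"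
    | (path) j where "e = {j, j + 1}" "Suc b \<le> j" "j \<le> Suc b + n - 1"
    | (high) u v where "e = {u, v}" "u \<noteq> v" "u \<in> {Suc b + n..Suc b + n + Suc a - 1}"
        "v \<in> {Suc b + n..Suc b + n + Suc a - 1}"
    unfolding K_plus_lollipop_def complete_edges_def by auto
  then show "e \<in> ?R"
  proof cases
    case low
    then show ?thesis using R' [of u v] by auto
  next
    case path
    then show ?thesis
      using R [of j "Suc j"] R [of b "Suc b"] by (cases "j + 1 \<le> a + n + Suc b") auto
  next
    case high
    then show ?thesis using R' [of u v] by auto
  qed
next
  fix e assume "e \<in> ?R"
  then obtain i j where e: "e = {a + n + Suc b - i, a + n + Suc b - j}" and
    ij: "i < j" "j \<le> a + n + b" "j \<le> a \<or> j = Suc i \<or> a + n \<le> i"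
    unfolding back_pairs_dumbbell length_dumbbell edge_of_pair_def by auto
  define u v where "u = a + n + Suc b - j" and "v = a + n + Suc b - i"
  have uv: "e = {u, v}" "1 \<le> u" "u < v" "v \<le> a + n + Suc b"
    "v \<le> Suc b \<or> v = Suc u \<or> Suc (b + n) \<le> u"
    using e ij by (auto simp: u_def v_def)
  \<comment> \<open>Consecutive vertices inside a clique fall under the clique cases; what remains
    satisfies exactly the bounds of the path edges.\<close>
  then consider "v \<le> Suc b" | "Suc (b + n) \<le> u" | "v = Suc u" "Suc b \<le> u" "u \<le> b + n"
    by linarith
  then show "e \<in> ?L"
  proof cases
    case 1
    with uv have "e \<in> complete_edges {1..Suc b}"
      unfolding complete_edges_def by (intro CollectI exI [of _ u] exI [of _ v]) auto
    then show ?thesis by (simp add: K_plus_lollipop_def)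
  next
    case 2
    with uv have "e \<in> complete_edges {Suc b + n..Suc b + n + Suc a - 1}"
      unfolding complete_edges_def by (intro CollectI exI [of _ u] exI [of _ v]) auto
    then show ?thesis unfolding K_plus_lollipop_def snd_conv by blast
  next
    case 3
    with uv have "e \<in> {{j, j + 1} |j. Suc b \<le> j \<and> j \<le> Suc b + n - 1}" by auto
    then show ?thesis unfolding K_plus_lollipop_def snd_conv by blast
  qed
qed

lemma chrom_qsym_K_plus_lollipop:
  "chrom_qsym (K_plus_lollipop (Suc b) (Suc a) n) = word_gen (<) (dumbbell a n b)"
  by (rule chrom_qsym_eq_word_gen [OF _ edges_K_plus_lollipop])
     (simp add: K_plus_lollipop_def length_dumbbell add_ac)

text \<open>A one-vertex clique has no edges. Thus the general formula also expands the lollipops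
  that occur in it, which makes their positivity accessible by induction.\<close>

lemma lollipop_eq: "lollipop (Suc a) n = K_plus_lollipop 1 (Suc a) n"
proof -
  have "complete_edges {1..1} = {}" by (auto simp: complete_edges_def)
  then show ?thesis by (simp add: lollipop_def K_plus_lollipop_def add_ac)
qed

lemma chrom_qsym_lollipop: "chrom_qsym (lollipop (Suc a) n) = word_gen (<) (dumbbell a n 0)"
  using chrom_qsym_K_plus_lollipop [of 0 a n] by (simp add: lollipop_eq)

text \<open>The hypothesis is that of \<open>bowtie_gen_eq\<close> for the upper clique after it has
  absorbed the whole path.\<close>

lemma chrom_qsym_K_plus_lollipop_formula:
  assumes "b \<le> Suc (a + n)"
  shows "chrom_qsym (K_plus_lollipop (Suc b) (Suc a) n) = mps_const (qfact a) *
    ((\<Sum>i\<le>b. mps_const (q ^ i * qfact b * qint (a + n + b + 1 - 2 * i)) *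
       (esym (a + n + b + 1 - i) * esym i)) +
     (\<Sum>j<n. mps_const (q * qint (a + n - 1 - j)) * chrom_qsym (lollipop (Suc b) j) * esym (a + n - j)))"
proof -
  have "clique_gen (<) (a + n) (stair (Suc b)) =
      (\<Sum>i\<le>b. mps_const (q ^ i * qfact b * qint (a + n + b + 1 - 2 * i)) *
       (esym (a + n + b + 1 - i) * esym i))"
  proof -
    have "clique_gen (<) (a + n) (stair (Suc b)) = mps_const (qfact b) *
        (\<Sum>i\<le>b. mps_const (q ^ i * qint (b + (a + n) + 1 - 2 * i)) *
          (esym (b + (a + n) + 1 - i) * esym i))"
      by (simp only: clique_gen_stair bowtie_gen_eq [OF assms])
    also have "b + (a + n) + 1 = a + n + b + 1" by simp
    finally show ?thesis
      by (simp add: sum_distrib_left mps_const_mult mult_ac)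
  qed
  then show ?thesis
    unfolding chrom_qsym_K_plus_lollipop chrom_qsym_lollipop word_gen_dumbbell [OF strict_total_less, of a n b]
    by (simp add: word_gen_lollipop [of _ b] mult_ac)
qed

section \<open>Positivity and unimodality\<close>

lemma esym_part_add_mset: "esym_part (add_mset k lam) = esym k * esym_part lam"
  by (simp add: esym_part_def)

text \<open>Products of elementary symmetric functions occur over \<open>int poly\<close> and over
  \<open>int\<close>. Since their coefficients are constant in \<open>q\<close>, extracting a power
  of \<open>q\<close> acts only on the scalar in front of them.\<close>

lemma mcoeff_esym_part_of_int:
  "mcoeff (esym_part lam :: int poly mps) M = of_int (mcoeff (esym_part lam :: int mps) M)"
proof (induction lam arbitrary: M)
  case empty
  show ?case by (simp add: esym_part_def one_mps_def)
next
  case (add k lam)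
  have "mcoeff (esym k :: int poly mps) A = of_int (mcoeff (esym k :: int mps) A)" for A
    unfolding esym_def mcoeff_Abs_mps by (simp only: if_distrib [of of_int] of_int_0 of_int_1)
  then show ?case
    using add.IH by (simp add: esym_part_add_mset times_mps_def case_prod_unfold)
qed

lemma mcoeff_qcoeff: "0 \<le> t \<Longrightarrow> mcoeff (qcoeff f t) M = coeff (mcoeff f M) (nat t)"
  by (simp add: qcoeff_def)

lemma qcoeff_neg: "t < 0 \<Longrightarrow> qcoeff f t = 0"
  by (simp add: qcoeff_def)

lemma qcoeff_add: "qcoeff (f + g) t = qcoeff f t + qcoeff g t"
  by (cases "t < 0") (auto simp: qcoeff_neg mcoeff_qcoeff mcoeff_add intro!: mps_eqI)

lemma qcoeff_0: "qcoeff 0 t = 0"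
  by (cases "t < 0") (auto simp: qcoeff_neg mcoeff_qcoeff mcoeff_0 intro!: mps_eqI)

lemma qcoeff_const_esym_part:
  "qcoeff (mps_const p * esym_part lam) t =
    mps_const (if t < 0 then 0 else coeff p (nat t)) * esym_part lam"
proof (cases "t < 0")
  case True
  then show ?thesis by (simp add: qcoeff_neg mps_const_0)
next
  case False
  then show ?thesis
    by (intro mps_eqI)
       (simp add: mcoeff_qcoeff mcoeff_const_mult mcoeff_esym_part_of_int of_int_poly mult.commute [where 'a = int])
qed

lemma coeff_q_power_qint: "coeff (q ^ i * qint k) t = (if i \<le> t \<and> t < i + k then 1 else 0)"
proof (induction k)
  case 0
  then show ?case by (simp add: qint_0)
next
  case (Suc k)
  have "q ^ i * q ^ k = monom 1 (i + k)"
    by (simp add: q_def monom_altdef power_add)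
  with Suc.IH show ?case by (auto simp: qint_Suc distrib_left)
qed

text \<open>The Clebsch-Gordan rule for q-integers: two blocks of ones multiply to a sum of nested
  blocks with a common center.\<close>

lemma qint_mult:
  assumes "b \<le> a"
  shows "qint a * qint b = (\<Sum>k<b. q ^ k * qint (a + b - 1 - 2 * k))"
proof -
  have "(q - 1) * (\<Sum>k<b. q ^ k * qint (a + b - 1 - 2 * k)) =
      (\<Sum>k<b. q ^ a * q ^ (b - Suc k) - q ^ k)"
    unfolding sum_distrib_left
  proof (rule sum.cong [OF refl])
    fix k assume "k \<in> {..<b}"
    with assms have "a + (b - Suc k) = k + (a + b - 1 - 2 * k)" by auto
    then have "q ^ a * q ^ (b - Suc k) = q ^ k * q ^ (a + b - 1 - 2 * k)"
      by (simp only: flip: power_add)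
    then show "(q - 1) * (q ^ k * qint (a + b - 1 - 2 * k)) = q ^ a * q ^ (b - Suc k) - q ^ k"
      unfolding mult.left_commute [of "q - 1"] q_minus_1_qint by (simp add: right_diff_distrib)
  qed
  \<comment> \<open>The exponents \<open>b - Suc k\<close> run through 0, ..., b - 1 in
    reverse.\<close>
  also have "\<dots> = q ^ a * qint b - qint b"
    unfolding sum_subtractf sum_distrib_left [symmetric] sum.nat_diff_reindex qint_def ..
  also have "\<dots> = (q - 1) * (qint a * qint b)"
    unfolding mult.assoc [symmetric] q_minus_1_qint by (simp add: left_diff_distrib)
  finally have "(q - 1) * (qint a * qint b) = (q - 1) * (\<Sum>k<b. q ^ k * qint (a + b - 1 - 2 * k))" ..
  moreover have "q - 1 \<noteq> 0" by (simp add: q_def one_pCons)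
  ultimately show ?thesis by (simp only: mult_cancel_left) simp
qed

text \<open>The polynomial $q^i [N+1-2i]_q$ is the block of ones in degrees $i, \dots, N-i$.\<close>

definition centered_term :: "nat \<Rightarrow> nat \<Rightarrow> nat multiset \<Rightarrow> int poly mps" where
  "centered_term N i lam = mps_const (q ^ i * qint (N + 1 - 2 * i)) * esym_part lam"

text \<open>\<open>N\<close> is twice the center and is fixed, so adding terms cannot spoil symmetry
  or the increase up to the middle. Nonnegative integer coefficients arise by adding a term
  repeatedly.\<close>

inductive_set unimodal_cone :: "nat \<Rightarrow> int poly mps set" for N where
  zero: "0 \<in> unimodal_cone N"
| add_term: "f \<in> unimodal_cone N \<Longrightarrow> 2 * i \<le> N \<Longrightarrow> 0 \<notin># lam \<Longrightarrow>
    f + centered_term N i lam \<in> unimodal_cone N"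

lemma cone_term: "2 * i \<le> N \<Longrightarrow> 0 \<notin># lam \<Longrightarrow> centered_term N i lam \<in> unimodal_cone N"
  using unimodal_cone.add_term [OF unimodal_cone.zero] by simp

lemma cone_add:
  assumes "g \<in> unimodal_cone N" and f: "f \<in> unimodal_cone N"
  shows "f + g \<in> unimodal_cone N"
  using assms(1)
proof induction
  case zero
  then show ?case using f by simp
next
  case (add_term g i lam)
  then show ?case
    using unimodal_cone.add_term [of "f + g"] by (simp add: add.assoc)
qed

lemma cone_sum: "(\<And>x. x \<in> A \<Longrightarrow> f x \<in> unimodal_cone N) \<Longrightarrow> (\<Sum>x\<in>A. f x) \<in> unimodal_cone N"
  by (induction A rule: infinite_finite_induct) (auto intro: cone_add unimodal_cone.zero)

lemma centered_term_mult:
  assumes "2 * i \<le> N" and "2 * j \<le> K" and "N + 1 - 2 * i \<le> K + 1 - 2 * j"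
    and "0 \<notin># lam" and "0 \<notin># mu"
  shows "centered_term N i lam * centered_term K j mu \<in> unimodal_cone (N + K)"
proof -
  define a b where "a = K + 1 - 2 * j" and "b = N + 1 - 2 * i"
  have "centered_term N i lam * centered_term K j mu =
      mps_const (q ^ (i + j) * (qint a * qint b)) * esym_part (lam + mu)"
    unfolding centered_term_def a_def b_def
    by (simp add: mps_const_mult power_add esym_part_def mult_ac)
  also have "q ^ (i + j) * (qint a * qint b) =
      (\<Sum>k<b. q ^ (i + j + k) * qint (N + K + 1 - 2 * (i + j + k)))"
  proof -
    \<comment> \<open>The blocks of the Clebsch-Gordan sum start in degree \<open>i + j + k\<close>;
      this length says that each is centered at half of \<open>N + K\<close>.\<close>
    have eq: "a + b - 1 - 2 * k = N + K + 1 - 2 * (i + j + k)" for k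
      using assms(1,2) by (simp add: a_def b_def)
    have "b \<le> a" using assms(3) by (simp only: a_def b_def)
    then show ?thesis
      by (simp only: qint_mult eq sum_distrib_left power_add mult.assoc)
  qed
  finally have "centered_term N i lam * centered_term K j mu =
      (\<Sum>k<b. centered_term (N + K) (i + j + k) (lam + mu))"
    unfolding mps_const_sum sum_distrib_right centered_term_def .
  also have "\<dots> \<in> unimodal_cone (N + K)"
    using assms by (intro cone_sum cone_term) (auto simp: b_def)
  finally show ?thesis .
qed

lemma cone_mult:
  assumes "f \<in> unimodal_cone N" and "g \<in> unimodal_cone K" and L: "L = N + K"
  shows "f * g \<in> unimodal_cone L"
  using assms(1)
proof induction
  case zero
  then show ?case by (simp add: unimodal_cone.zero)
next
  case (add_term f i lam)
  from assms(2) have "centered_term N i lam * g \<in> unimodal_cone L"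
  proof induction
    case zero
    then show ?case by (simp add: unimodal_cone.zero)
  next
    case (add_term g j mu)
    have "centered_term N i lam * centered_term K j mu \<in> unimodal_cone L"
    proof (cases "N + 1 - 2 * i \<le> K + 1 - 2 * j")
      case True
      then show ?thesis
        unfolding L using add_term \<open>2 * i \<le> N\<close> \<open>0 \<notin># lam\<close> by (intro centered_term_mult)
    next
      case False
      then have "centered_term K j mu * centered_term N i lam \<in> unimodal_cone (K + N)"
        using add_term \<open>2 * i \<le> N\<close> \<open>0 \<notin># lam\<close> by (intro centered_term_mult) auto
      then show ?thesis by (simp add: L mult.commute add.commute)
    qed
    with add_term.IH show ?case by (simp add: distrib_left cone_add)
  qed
  with add_term.IH show ?case by (simp add: distrib_right cone_add)
qed

lemma cone_const: "k \<noteq> 0 \<Longrightarrow> N + 1 = 2 * i + k \<Longrightarrow> mps_const (q ^ i * qint k) \<in> unimodal_cone N"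
  using cone_term [of i N "{#}"] by (simp add: centered_term_def esym_part_def)

lemma cone_qint: "mps_const (qint (Suc k)) \<in> unimodal_cone k"
  using cone_const [of "Suc k" k 0] by simp

text \<open>The ones stand in degrees 1, ..., k, with center half of \<open>k + 1\<close>; for
  \<open>k = 0\<close> the series is zero and lies in every cone.\<close>

lemma cone_q_qint: "N = Suc k \<or> k = 0 \<Longrightarrow> mps_const (q * qint k) \<in> unimodal_cone N"
  using cone_const [of k N 1] by (cases "k = 0") (auto simp: qint_0 mps_const_0 unimodal_cone.zero)

lemma cone_qfact: "mps_const (qfact k) \<in> unimodal_cone (k choose 2)"
proof (induction k)
  case 0
  then show ?case using cone_qint [of 0] by (simp add: qfact_0 qint_def numeral_2_eq_2)
next
  case (Suc k)
  have "(Suc k choose 2) = k + (k choose 2)" by (simp add: numeral_2_eq_2)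
  then show ?case
    unfolding qfact_Suc mps_const_mult by (intro cone_mult [OF cone_qint Suc.IH])
qed

lemma cone_esym: "esym k \<in> unimodal_cone 0"
proof (cases "k = 0")
  case True
  then show ?thesis using cone_qint [of 0] by (simp add: esym_0 qint_def mps_const_1)
next
  case False
  then show ?thesis
    using cone_term [of 0 0 "{#k#}"]
    by (simp add: centered_term_def esym_part_def qint_def mps_const_1)
qed

text \<open>All summands have the same center. The first sum carries \<open>a + n + b\<close> from
  its block and \<open>b choose 2\<close> from \<open>qfact b\<close>; in the second,
  \<open>a + n - j\<close> from the q-integer and \<open>j\<close> from the path of the lollipop add
  up to \<open>a + n\<close>. The outer \<open>qfact a\<close> adds \<open>a choose 2\<close> to
  both.\<close>

lemma chrom_qsym_cone_step:
  assumes "b \<le> a"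
    and "\<And>j. j < n \<Longrightarrow> chrom_qsym (lollipop (Suc b) j) \<in> unimodal_cone ((Suc b choose 2) + j)"
  shows "chrom_qsym (K_plus_lollipop (Suc b) (Suc a) n) \<in>
    unimodal_cone ((Suc a choose 2) + n + (Suc b choose 2))"
proof -
  have choose: "(Suc k choose 2) = k + (k choose 2)" for k by (simp add: numeral_2_eq_2)
  have first: "mps_const (q ^ i * qfact b * qint (a + n + b + 1 - 2 * i)) *
      (esym (a + n + b + 1 - i) * esym i) \<in> unimodal_cone (a + n + (Suc b choose 2))"
    if "i \<in> {..b}" for i
  proof -
    have "q ^ i * qfact b * qint (a + n + b + 1 - 2 * i) =
        (q ^ i * qint (a + n + b + 1 - 2 * i)) * qfact b"
      by (simp add: mult_ac)
    \<comment> \<open>\<open>b \<le> a\<close> makes the block nonempty for every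
      \<open>i \<le> b\<close>.\<close>
    moreover have "mps_const (q ^ i * qint (a + n + b + 1 - 2 * i)) \<in> unimodal_cone (a + n + b)"
      using that assms(1) by (intro cone_const) auto
    moreover have "a + n + (Suc b choose 2) = a + n + b + (b choose 2)"
      by (simp add: choose)
    ultimately have "mps_const (q ^ i * qfact b * qint (a + n + b + 1 - 2 * i)) \<in>
        unimodal_cone (a + n + (Suc b choose 2))"
      by (simp only: mps_const_mult [of _ "qfact b"] cone_mult [OF _ cone_qfact refl])
    then show ?thesis
      by (rule cone_mult [OF _ cone_mult [OF cone_esym cone_esym refl]]) simp
  qed
  have second: "mps_const (q * qint (a + n - 1 - j)) * chrom_qsym (lollipop (Suc b) j) *
      esym (a + n - j) \<in> unimodal_cone (a + n + (Suc b choose 2))"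
    if "j \<in> {..<n}" for j
  proof -
    have "mps_const (q * qint (a + n - 1 - j)) \<in> unimodal_cone (a + n - j)"
      using that by (intro cone_q_qint) auto
    then have "mps_const (q * qint (a + n - 1 - j)) * chrom_qsym (lollipop (Suc b) j) \<in>
        unimodal_cone (a + n + (Suc b choose 2))"
      by (rule cone_mult [OF _ assms(2)]) (use that in auto)
    then show ?thesis by (rule cone_mult [OF _ cone_esym]) simp
  qed
  have "b \<le> Suc (a + n)" using assms(1) by simp
  moreover have "(Suc a choose 2) + n + (Suc b choose 2) = (a choose 2) + (a + n + (Suc b choose 2))"
    by (simp add: choose)
  ultimately show ?thesis
    by (simp only: chrom_qsym_K_plus_lollipop_formula)
       (intro cone_mult [OF cone_qfact cone_add [OF cone_sum cone_sum] refl] first second)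
qed

text \<open>For a one-vertex lower clique the expansion involves only the lollipops with clique size
  1 and \<open>j < n\<close>, which are shorter paths, so induction on \<open>n\<close>
  suffices.\<close>

lemma chrom_qsym_lollipop_cone:
  "chrom_qsym (lollipop (Suc a) n) \<in> unimodal_cone ((Suc a choose 2) + n)"
proof (induction n arbitrary: a rule: less_induct)
  case (less n)
  show ?case
    using chrom_qsym_cone_step [of 0 a n] less.IH [of _ 0]
    by (simp add: lollipop_eq numeral_2_eq_2)
qed

text \<open>For a relation that always holds, \<open>word_asc\<close> counts all edges, and
  \<open>as\<close> itself serves as a dummy word of the right length. The hypothesis ensures that
  \<open>take\<close> never runs past the end of the word.\<close>

lemma card_back_pairs:
  assumes "\<And>i. i < length as \<Longrightarrow> i + as ! i < length as"
  shows "card (back_pairs as) = sum_list as"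
proof -
  have "word_asc (\<lambda>_ _. True) as as = sum_list as"
  proof -
    have "length cs = length as \<Longrightarrow> word_asc (\<lambda>_ _. True) as cs = sum_list as" for cs
      using assms
    proof (induction as arbitrary: cs)
      case (Cons a as)
      from Cons.prems(1) obtain c ds where cs: "cs = c # ds" "length ds = length as"
        by (cases cs) auto
      have "a \<le> length as" using Cons.prems(2) [of 0] by simp
      moreover have "word_asc (\<lambda>_ _. True) as ds = sum_list as"
        using Cons.prems(2) [of "Suc _"] by (intro Cons.IH cs(2)) auto
      ultimately show ?case by (simp add: cs)
    qed simp
    then show ?thesis by simp
  qed
  then show ?thesis by (simp add: word_asc_eq_card)
qed

lemma card_edges_K_plus_lollipop:
  "card (edges (K_plus_lollipop (Suc b) (Suc a) n)) = (Suc a choose 2) + n + (Suc b choose 2)"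
proof -
  have stair: "sum_list (stair k) = (k choose 2)" for k
    by (induction k) (simp_all add: numeral_2_eq_2)
  have stair1: "sum_list (stair1 k) = (Suc k choose 2)" for k
    using stair [of "Suc k"] unfolding stair_Suc by simp
  have "card (edges (K_plus_lollipop (Suc b) (Suc a) n)) = card (back_pairs (dumbbell a n b))"
    unfolding edges_K_plus_lollipop by (rule card_image [OF inj_edge_of_pair])
  also have "\<dots> = sum_list (dumbbell a n b)"
    by (rule card_back_pairs) (auto simp: length_dumbbell dumbbell_nth)
  also have "\<dots> = (Suc a choose 2) + n + (Suc b choose 2)"
    unfolding dumbbell_def sum_list_append stair stair1 by (simp add: sum_list_replicate)
  finally show ?thesis .
qed

section \<open>From the cone to e-positivity and e-unimodality\<close>

lemma e_positive_sym_0: "e_positive_sym 0"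
  unfolding e_positive_sym_def by (intro exI [of _ "{}"]) simp

lemma e_positive_sym_term: "0 \<notin># lam \<Longrightarrow> 0 \<le> a \<Longrightarrow> e_positive_sym (mps_const a * esym_part lam)"
  unfolding e_positive_sym_def by (intro exI [of _ "{lam}"] exI [of _ "\<lambda>_. a"]) simp

lemma e_positive_sym_add:
  assumes "e_positive_sym f" and "e_positive_sym g"
  shows "e_positive_sym (f + g)"
proof -
  from assms obtain S a T b where S: "finite S" "\<forall>lam\<in>S. 0 \<notin># lam \<and> 0 \<le> a lam"
      "f = (\<Sum>lam\<in>S. mps_const (a lam) * esym_part lam)"
    and T: "finite T" "\<forall>lam\<in>T. 0 \<notin># lam \<and> 0 \<le> b lam"
      "g = (\<Sum>lam\<in>T. mps_const (b lam) * esym_part lam)"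
    unfolding e_positive_sym_def by blast
  define a' where "a' lam = (if lam \<in> S then a lam else 0)" for lam
  define b' where "b' lam = (if lam \<in> T then b lam else 0)" for lam
  have "f = (\<Sum>lam\<in>S \<union> T. mps_const (a' lam) * esym_part lam)"
    unfolding S(3) using S(1) T(1)
    by (intro sum.mono_neutral_cong_left) (auto simp: a'_def mps_const_0)
  moreover have "g = (\<Sum>lam\<in>S \<union> T. mps_const (b' lam) * esym_part lam)"
    unfolding T(3) using S(1) T(1)
    by (intro sum.mono_neutral_cong_left) (auto simp: b'_def mps_const_0)
  ultimately have "f + g = (\<Sum>lam\<in>S \<union> T. mps_const (a' lam + b' lam) * esym_part lam)"
    by (simp add: mps_const_add distrib_right sum.distrib)
  moreover have "\<forall>lam\<in>S \<union> T. 0 \<notin># lam \<and> 0 \<le> a' lam + b' lam"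
    using S(2) T(2) by (auto simp: a'_def b'_def)
  ultimately show ?thesis
    unfolding e_positive_sym_def using S(1) T(1)
    by (intro exI [of _ "S \<union> T"] exI [of _ "\<lambda>lam. a' lam + b' lam"]) simp
qed

lemma qcoeff_centered_term:
  assumes "2 * i \<le> N"
  shows "qcoeff (centered_term N i lam) t =
    mps_const (if int i \<le> t \<and> t \<le> int N - int i then 1 else 0) * esym_part lam"
  unfolding centered_term_def qcoeff_const_esym_part coeff_q_power_qint
  by (rule arg_cong [where f = "\<lambda>c. mps_const c * esym_part lam"]) (use assms in auto)

lemma cone_symmetric:
  assumes "f \<in> unimodal_cone N"
  shows "qcoeff f t = qcoeff f (int N - t)"
  using assms
proof induction
  case zero
  then show ?case by (simp add: qcoeff_0)
next
  case (add_term f i lam)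
  then show ?case
    by (auto simp: qcoeff_add qcoeff_centered_term intro!: arg_cong [where f = "\<lambda>c. mps_const c * esym_part lam"])
qed

lemma cone_e_positive:
  assumes "f \<in> unimodal_cone N"
  shows "e_positive_sym (qcoeff f t)"
  using assms
proof induction
  case zero
  then show ?case by (simp add: qcoeff_0 e_positive_sym_0)
next
  case (add_term f i lam)
  then show ?case
    by (simp add: qcoeff_add qcoeff_centered_term e_positive_sym_add e_positive_sym_term)
qed

lemma cone_increasing:
  assumes "f \<in> unimodal_cone N" and t: "2 * t + 2 \<le> int N"
  shows "e_positive_sym (qcoeff f (t + 1) - qcoeff f t)"
  using assms(1)
proof induction
  case zero
  then show ?case by (simp add: qcoeff_0 e_positive_sym_0)
next
  case (add_term f i lam)
  define c where "c t = (if int i \<le> t \<and> t \<le> int N - int i then 1 else 0 :: int)" for t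
  \<comment> \<open>A block may begin at \<open>t + 1\<close> but cannot end at \<open>t\<close>: if
    \<open>i \<le> t\<close>, then \<open>N - i\<close> is at least \<open>t + 2\<close>.\<close>
  have "0 \<le> c (t + 1) - c t" using t by (auto simp: c_def)
  then have "e_positive_sym (mps_const (c (t + 1) - c t) * esym_part lam)"
    using add_term by (intro e_positive_sym_term)
  moreover have "mps_const (c (t + 1)) = mps_const (c (t + 1) - c t) + mps_const (c t)"
    by (simp flip: mps_const_add)
  ultimately have "e_positive_sym (mps_const (c (t + 1)) * esym_part lam - mps_const (c t) * esym_part lam)"
    by (simp add: distrib_right)
  from e_positive_sym_add [OF add_term.IH this] show ?case
    using add_term by (simp add: qcoeff_add qcoeff_centered_term c_def algebra_simps)
qed

lemma cone_e_unimodal: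
  assumes "f \<in> unimodal_cone N"
  shows "e_positive f" and "e_unimodal f (real N / 2)"
proof -
  show "e_positive f"
    unfolding e_positive_def using cone_e_positive [OF assms] by blast
  have "e_positive_sym (qcoeff f (t + 1) - qcoeff f t)" if "of_int t < real N / 2 - 1 / 2" for t
  proof (rule cone_increasing [OF assms])
    \<comment> \<open>Doubling clears the halves, and strictness between integers supplies the
      missing 1.\<close>
    have "real_of_int (2 * t + 1) < real_of_int (int N)" using that by simp
    then have "2 * t + 1 < int N" by (simp only: of_int_less_iff)
    then show "2 * t + 2 \<le> int N" by simp
  qed
  then show "e_unimodal f (real N / 2)"
    unfolding e_unimodal_def using cone_symmetric [OF assms]
    by (intro conjI exI [of _ "int N"] allI impI) auto
qed

theorem theorem4p6:
  fixes m n r d :: nat and G :: graph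
  assumes "3 \<le> m" and "1 \<le> r" and "r \<le> m"
    and "d = n + m + r - 1"
    and "G = K_plus_lollipop r m n"
  shows "chrom_qsym G =
           mps_const (qfact (m - 1)) *
             ((\<Sum>i = 0..r - 1. mps_const (q ^ i * qfact (r - 1) * qint (d - 2 * i)) *
                 (esym (d - i) * esym i)) +
              (\<Sum>j<n. mps_const (q * qint (n + m - j - 2)) *
                 chrom_qsym (lollipop r j) * esym (n + m - j - 1))) \<and>
         e_positive (chrom_qsym G) \<and>
         e_unimodal (chrom_qsym G) (real (card (edges G)) / 2)"
proof -
  \<comment> \<open>\<open>a\<close> and \<open>b\<close> are the numbers of vertices that the two
    cliques have besides the one at which each is glued to the path.\<close>
  obtain a where m: "m = Suc a" using assms(1) by (cases m) auto
  obtain b where r: "r = Suc b" using assms(2) by (cases r) auto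
  have ba: "b \<le> a" and d: "d = a + n + b + 1" and G: "G = K_plus_lollipop (Suc b) (Suc a) n"
    using assms(3-5) by (simp_all add: m r)
  have j: "n + Suc a - j - 2 = a + n - 1 - j" "n + Suc a - j - 1 = a + n - j" for j by auto
  have "b \<le> Suc (a + n)" using ba by simp
  from chrom_qsym_K_plus_lollipop_formula [OF this]
  have formula: "chrom_qsym G = mps_const (qfact (m - 1)) *
       ((\<Sum>i = 0..r - 1. mps_const (q ^ i * qfact (r - 1) * qint (d - 2 * i)) *
           (esym (d - i) * esym i)) +
        (\<Sum>j<n. mps_const (q * qint (n + m - j - 2)) *
           chrom_qsym (lollipop r j) * esym (n + m - j - 1)))"
    by (simp only: G m r d j atMost_atLeast0 diff_Suc_1)
  have "chrom_qsym G \<in> unimodal_cone (card (edges G))"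
    unfolding G card_edges_K_plus_lollipop
    by (rule chrom_qsym_cone_step [OF ba chrom_qsym_lollipop_cone])
  then show ?thesis
    using formula cone_e_unimodal by blast
qed

end
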